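(* Let $r\ge 1$ and, for $l=1,\dots,r$, let $A_l=A_{l1}+A_{l2}\mathbf{j}\in \mathbb{Q}_{\mathbb{R}}^{m\times n_l}$ (with $A_{l1},A_{l2}\in\mathbb{C}^{m\times n_l}$), $B_l\in \mathbb{Q}_{\mathbb{R}}^{s_l\times t}$, and let $E\in \mathbb{Q}_{\mathbb{R}}^{m\times t}$. For each $l$ let $L_l(n_l,s_l)\subseteq \mathbb{Q}_{\mathbb{R}}^{n_l\times s_l}$ be a reduced biquaternion L-structure, with basis matrix $M_{L_l}$. Let $\mathcal{N}_{LE}$ be the set of all tuples $[X_1,\dots,X_r]$ with $X_l\in L_l(n_l,s_l)$ and $$\Big\|\sum_{l=1}^r A_lX_lB_l-E\Big\|_F=\min_{\widetilde X_l\in L_l(n_l,s_l)}\Big\|\sum_{l=1}^r A_l\widetilde X_lB_l-E\Big\|_F .$$ Define $$S_l=\big(h(B_l)^T\otimes A_{l1}+h(B_l\mathbf{j})^T\otimes A_{l2}\big)\mathcal{W}_{n_ls_l}M_{L_l},\qquad Q_1=[\Re(S_1),\dots,\Re(S_r)],\quad Q_2=[\Im(S_1),\dots,\Im(S_r)],$$ $$e=\begin{bmatrix}\mathrm{vec}(\Re(\Psi_E))\\ \mathrm{vec}(\Im(\Psi_E))\end{bmatrix},\qquad \mathcal{T}=\mathrm{diag}(M_{L_1},\dots,M_{L_r})\ \text{(block diagonal)},$$ $$R=(I-Q_1^+Q_1)Q_2^T,\quad Z=\big(I+(I-R^+R)Q_2Q_1^+Q_1^{+T}Q_2^T(I-R^+R)\big)^{-1},$$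 $$H=R^++(I-R^+R)ZQ_2Q_1^+Q_1^{+T}(I-Q_2^TR^+).$$ Then $\mathcal{N}_{LE}$ is exactly the set of $[X_1,\dots,X_r]$ such that $$\begin{bmatrix}\mathrm{vec}(\overrightarrow{X_1})\\ \vdots\\ \mathrm{vec}(\overrightarrow{X_r})\end{bmatrix}=\mathcal{T}\,[Q_1^+-H^TQ_2Q_1^+,\;H^T]\,e+\mathcal{T}\,(I-Q_1^+Q_1-RR^+)\,y$$ for some real vector $y$ of suitable size (all real $y$ being allowed). Moreover, there is a unique $[X_{1E},\dots,X_{rE}]\in\mathcal{N}_{LE}$ satisfying $$\|[X_{1E},\dots,X_{rE}]\|_F=\min_{[X_1,\dots,X_r]\in\mathcal{N}_{LE}}\big(\|X_1\|_F^2+\cdots+\|X_r\|_F^2\big)^{1/2},$$ and it satisfies $$\begin{bmatrix}\mathrm{vec}(\overrightarrow{X_{1E}})\\ \vdots\\ \mathrm{vec}(\overrightarrow{X_{rE}})\end{bmatrix}=\mathcal{T}\,[Q_1^+-H^TQ_2Q_1^+,\;H^T]\,e .$$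
   Context: Reduced biquaternions: $\mathbb{Q}_{\mathbb{R}}$ is the commutative ring of elements $r_0+r_1\mathbf{i}+r_2\mathbf{j}+r_3\mathbf{k}$, $r_i\in\mathbb{R}$, with $\mathbf{i}^2=\mathbf{k}^2=-1$, $\mathbf{j}^2=1$, $\mathbf{i}\mathbf{j}=\mathbf{j}\mathbf{i}=\mathbf{k}$, $\mathbf{j}\mathbf{k}=\mathbf{k}\mathbf{j}=\mathbf{i}$, $\mathbf{k}\mathbf{i}=\mathbf{i}\mathbf{k}=-\mathbf{j}$. Every $Z\in\mathbb{Q}_{\mathbb{R}}^{p\times q}$ is uniquely $Z=Z_1+Z_2\mathbf{j}$ with $Z_1,Z_2\in\mathbb{C}^{p\times q}$ (where $\mathbb{C}=\mathbb{R}+\mathbb{R}\mathbf{i}$). Set $\Psi_Z=[Z_1,Z_2]\in\mathbb{C}^{p\times 2q}$, $h(Z)=\begin{bmatrix}Z_1&Z_2\\Z_2&Z_1\end{bmatrix}$ (so $h(Z\mathbf{j})=\begin{bmatrix}Z_2&Z_1\\Z_1&Z_2\end{bmatrix}$), and $\overrightarrow{Z}=[\Re(Z_1),\Im(Z_1),\Re(Z_2),\Im(Z_2)]\in\mathbb{R}^{p\times 4q}$. The norm of an element is $\sqrt{r_0^2+r_1^2+r_2^2+r_3^2}$, and $\|Z\|_F$ is the square root of the sum of squared norms of the entries, i.e. $\|Z\|_F=\|\mathrm{vec}(\overrightarrow Z)\|_2$. For a tuple, $\|[X_1,\dots,X_r]\|_F=(\sum_l\|X_l\|_F^2)^{1/2}$.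 $\mathrm{vec}$ stacks the columns of a matrix; $\otimes$ is the Kronecker product; $M^+$ is the Moore–Penrose inverse of a real matrix, $M^{+T}=(M^+)^T$; $\Re,\Im$ are entrywise real and imaginary parts; $I$ denotes identity matrices of suitable size. $$\mathcal{W}_{N}=\begin{bmatrix}I_N&\mathbf{i}I_N&0&0\\0&0&I_N&\mathbf{i}I_N\end{bmatrix}\in\mathbb{C}^{2N\times 4N}.$$ L-structure: given an $\mathbb{R}$-linear subspace $\Omega\subseteq\mathbb{Q}_{\mathbb{R}}^{pq}$, the associated reduced biquaternion L-structure is $L(p,q)=\{X\in\mathbb{Q}_{\mathbb{R}}^{p\times q}: \mathrm{vec}(X)\in\Omega\}$. Let $\mathcal{G}=\{\mathrm{vec}(\overrightarrow X): X\in L(p,q)\}$, a linear subspace of $\mathbb{R}^{4pq}$. A basis matrix $M_L$ of the structure is a real matrix whose columns form a basis of $\mathcal{G}$.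
   Formalization: The final formula for the minimal norm solution is proved only when every basis matrix M_{L_l} has orthonormal columns; for an arbitrary basis matrix it is false (A=E=1+j, B=1, L={a+bj}, basis 1, 1+j gives 3/5+2/5 j instead of 1/2+1/2 j). *)

theory Defs
  imports
    Complex_Main
    "Jordan_Normal_Form.Gauss_Jordan_Elimination"
    "Jordan_Normal_Form.VS_Connect"
begin

section \<open>Reduced biquaternions\<close>

text \<open>RBQ r0 r1 r2 r3 is the element r0 + r1 i + r2 j + r3 k.\<close>

datatype rbq = RBQ (rb0: real) (rb1: real) (rb2: real) (rb3: real)

lemma rbq_eq_iff: "x = y \<longleftrightarrow> rb0 x = rb0 y \<and> rb1 x = rb1 y \<and> rb2 x = rb2 y \<and> rb3 x = rb3 y"
  by (cases x; cases y) simp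

instantiation rbq :: comm_ring_1
begin

definition zero_rbq :: rbq where "0 = RBQ 0 0 0 0"
definition one_rbq :: rbq where "1 = RBQ 1 0 0 0"
definition plus_rbq :: "rbq \<Rightarrow> rbq \<Rightarrow> rbq" where
  "x + y = RBQ (rb0 x + rb0 y) (rb1 x + rb1 y) (rb2 x + rb2 y) (rb3 x + rb3 y)"
definition uminus_rbq :: "rbq \<Rightarrow> rbq" where
  "- x = RBQ (- rb0 x) (- rb1 x) (- rb2 x) (- rb3 x)"
definition minus_rbq :: "rbq \<Rightarrow> rbq \<Rightarrow> rbq" where
  "x - y = RBQ (rb0 x - rb0 y) (rb1 x - rb1 y) (rb2 x - rb2 y) (rb3 x - rb3 y)"

text \<open>Bilinear extension of the multiplication table, which is recovered below.\<close>

definition times_rbq :: "rbq \<Rightarrow> rbq \<Rightarrow> rbq" where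
  "x * y = RBQ
     (rb0 x * rb0 y - rb1 x * rb1 y + rb2 x * rb2 y - rb3 x * rb3 y)
     (rb0 x * rb1 y + rb1 x * rb0 y + rb2 x * rb3 y + rb3 x * rb2 y)
     (rb0 x * rb2 y + rb2 x * rb0 y - rb1 x * rb3 y - rb3 x * rb1 y)
     (rb0 x * rb3 y + rb3 x * rb0 y + rb1 x * rb2 y + rb2 x * rb1 y)"

instance
  by standard
    (simp_all add: rbq_eq_iff zero_rbq_def one_rbq_def plus_rbq_def uminus_rbq_def
      minus_rbq_def times_rbq_def algebra_simps)

end

instantiation rbq :: real_algebra_1
begin

definition scaleR_rbq :: "real \<Rightarrow> rbq \<Rightarrow> rbq" where
  "c *\<^sub>R x = RBQ (c * rb0 x) (c * rb1 x) (c * rb2 x) (c * rb3 x)"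

instance
  by standard
    (simp_all add: rbq_eq_iff plus_rbq_def times_rbq_def scaleR_rbq_def algebra_simps)

end

definition rb_norm :: "rbq \<Rightarrow> real" where
  "rb_norm x = sqrt ((rb0 x)\<^sup>2 + (rb1 x)\<^sup>2 + (rb2 x)\<^sup>2 + (rb3 x)\<^sup>2)"

definition rb_i :: rbq where "rb_i = RBQ 0 1 0 0"
definition rb_j :: rbq where "rb_j = RBQ 0 0 1 0"
definition rb_k :: rbq where "rb_k = RBQ 0 0 0 1"

definition rb_of_complex :: "complex \<Rightarrow> rbq" where
  "rb_of_complex z = RBQ (Re z) (Im z) 0 0"

definition cpart1 :: "rbq \<Rightarrow> complex" where "cpart1 x = Complex (rb0 x) (rb1 x)"
definition cpart2 :: "rbq \<Rightarrow> complex" where "cpart2 x = Complex (rb2 x) (rb3 x)"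

lemma rbq_multiplication_table:
  "rb_i * rb_i = - 1" "rb_k * rb_k = - 1" "rb_j * rb_j = 1"
  "rb_i * rb_j = rb_k" "rb_j * rb_i = rb_k"
  "rb_j * rb_k = rb_i" "rb_k * rb_j = rb_i"
  "rb_k * rb_i = - rb_j" "rb_i * rb_k = - rb_j"
  by (simp_all add: rbq_eq_iff rb_i_def rb_j_def rb_k_def times_rbq_def uminus_rbq_def one_rbq_def)

lemma rbq_expansion:
  "x = of_real (rb0 x) + of_real (rb1 x) * rb_i + of_real (rb2 x) * rb_j + of_real (rb3 x) * rb_k"
  by (simp add: rbq_eq_iff of_real_def rb_i_def rb_j_def rb_k_def times_rbq_def plus_rbq_def
      one_rbq_def scaleR_rbq_def)

lemma rbq_complex_parts:
  "x = rb_of_complex z + rb_of_complex w * rb_j \<longleftrightarrow> z = cpart1 x \<and> w = cpart2 x"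
  by (auto simp: rbq_eq_iff rb_of_complex_def cpart1_def cpart2_def rb_j_def times_rbq_def
      plus_rbq_def complex_eq_iff)

section \<open>Matrix operations\<close>

definition append_cols :: "'a::zero mat \<Rightarrow> 'a mat \<Rightarrow> 'a mat" where
  "append_cols A B = four_block_mat A B (0\<^sub>m 0 (dim_col A)) (0\<^sub>m 0 (dim_col B))"

definition hconcat :: "nat \<Rightarrow> 'a mat list \<Rightarrow> 'a mat" where
  "hconcat nr As = mat_of_cols nr (concat (map cols As))"

definition vconcat :: "'a vec list \<Rightarrow> 'a vec" where
  "vconcat vs = vec_of_list (concat (map list_of_vec vs))"

text \<open>The usual vec operator (columns stacked on top of each other).\<close>

definition vec_of_mat :: "'a mat \<Rightarrow> 'a vec" where
  "vec_of_mat A = vconcat (cols A)"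

definition kronecker :: "'a::times mat \<Rightarrow> 'a mat \<Rightarrow> 'a mat" where
  "kronecker A B = mat (dim_row A * dim_row B) (dim_col A * dim_col B)
     (\<lambda>(i, j). A $$ (i div dim_row B, j div dim_col B) * B $$ (i mod dim_row B, j mod dim_col B))"

text \<open>The four Penrose equations determine X uniquely.\<close>

definition is_pseudo_inverse :: "real mat \<Rightarrow> real mat \<Rightarrow> bool" where
  "is_pseudo_inverse A X \<longleftrightarrow>
     X \<in> carrier_mat (dim_col A) (dim_row A) \<and>
     A * X * A = A \<and> X * A * X = X \<and>
     transpose_mat (A * X) = A * X \<and> transpose_mat (X * A) = X * A"

definition pinv :: "real mat \<Rightarrow> real mat" where
  "pinv A = (THE X. is_pseudo_inverse A X)"

definition inv_mat :: "'a::field mat \<Rightarrow> 'a mat" where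
  "inv_mat A = the (mat_inverse A)"

section \<open>Representations of reduced biquaternion matrices\<close>

definition cmat1 :: "rbq mat \<Rightarrow> complex mat" where "cmat1 Z = map_mat cpart1 Z"
definition cmat2 :: "rbq mat \<Rightarrow> complex mat" where "cmat2 Z = map_mat cpart2 Z"

definition Psi :: "rbq mat \<Rightarrow> complex mat" where
  "Psi Z = append_cols (cmat1 Z) (cmat2 Z)"

definition h_rep :: "rbq mat \<Rightarrow> complex mat" where
  "h_rep Z = four_block_mat (cmat1 Z) (cmat2 Z) (cmat2 Z) (cmat1 Z)"

definition real_rep :: "rbq mat \<Rightarrow> real mat" where
  "real_rep Z = hconcat (dim_row Z)
     [map_mat Re (cmat1 Z), map_mat Im (cmat1 Z), map_mat Re (cmat2 Z), map_mat Im (cmat2 Z)]"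

definition fro_norm :: "rbq mat \<Rightarrow> real" where
  "fro_norm Z = sqrt (\<Sum>i<dim_row Z. \<Sum>j<dim_col Z. (rb_norm (Z $$ (i, j)))\<^sup>2)"

definition tuple_fro_norm :: "rbq mat list \<Rightarrow> real" where
  "tuple_fro_norm Xs = sqrt (\<Sum>X\<leftarrow>Xs. (fro_norm X)\<^sup>2)"

definition W_mat :: "nat \<Rightarrow> complex mat" where
  "W_mat N = four_block_mat
     (append_cols (1\<^sub>m N) (\<i> \<cdot>\<^sub>m 1\<^sub>m N)) (0\<^sub>m N (2 * N))
     (0\<^sub>m N (2 * N)) (append_cols (1\<^sub>m N) (\<i> \<cdot>\<^sub>m 1\<^sub>m N))"

section \<open>L-structures\<close>

text \<open>Vectors of the matrix library carry no real vector space type class, so real linearity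
  is expressed through scalars of the form of_real c.\<close>

definition real_subspace :: "nat \<Rightarrow> rbq vec set \<Rightarrow> bool" where
  "real_subspace N \<Omega> \<longleftrightarrow>
     \<Omega> \<subseteq> carrier_vec N \<and> 0\<^sub>v N \<in> \<Omega> \<and>
     (\<forall>u\<in>\<Omega>. \<forall>v\<in>\<Omega>. u + v \<in> \<Omega>) \<and>
     (\<forall>c::real. \<forall>v\<in>\<Omega>. of_real c \<cdot>\<^sub>v v \<in> \<Omega>)"

definition L_structure :: "nat \<Rightarrow> nat \<Rightarrow> rbq vec set \<Rightarrow> rbq mat set" where
  "L_structure p q \<Omega> = {X \<in> carrier_mat p q. vec_of_mat X \<in> \<Omega>}"

text \<open>The columns of M, listed without repetition, form a basis of the coordinate space of
  the structure L of p by q matrices. M has no columns if L is trivial.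
  The columns need not be orthonormal, so coefficient vectors with respect to M need not have
  the Frobenius norm of the matrices they represent.\<close>

definition basis_matrix :: "nat \<Rightarrow> nat \<Rightarrow> rbq mat set \<Rightarrow> real mat \<Rightarrow> bool" where
  "basis_matrix p q L M \<longleftrightarrow>
     dim_row M = 4 * p * q \<and> distinct (cols M) \<and>
     LinearCombinations.module.lin_indpt class_ring (module_vec TYPE(real) (4 * p * q))
       (set (cols M)) \<and>
     LinearCombinations.module.span class_ring (module_vec TYPE(real) (4 * p * q))
       (set (cols M)) = (\<lambda>X. vec_of_mat (real_rep X)) ` L"

section \<open>The least squares problem\<close>

text \<open>Tuples [X_1, ..., X_r] are lists of length r, and indices are shifted to 0, ..., r - 1.\<close>

definition residual :: "nat \<Rightarrow> nat \<Rightarrow> nat \<Rightarrow> (nat \<Rightarrow> rbq mat) \<Rightarrow> (nat \<Rightarrow> rbq mat) \<Rightarrow> rbq mat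
    \<Rightarrow> rbq mat list \<Rightarrow> rbq mat" where
  "residual r m t A B E Xs = mat m t (\<lambda>ij. \<Sum>l<r. (A l * Xs ! l * B l) $$ ij) - E"

definition feasible_tuples :: "nat \<Rightarrow> (nat \<Rightarrow> rbq mat set) \<Rightarrow> rbq mat list set" where
  "feasible_tuples r L = {Xs. length Xs = r \<and> (\<forall>l<r. Xs ! l \<in> L l)}"

definition N_LE :: "nat \<Rightarrow> nat \<Rightarrow> nat \<Rightarrow> (nat \<Rightarrow> rbq mat) \<Rightarrow> (nat \<Rightarrow> rbq mat) \<Rightarrow> rbq mat
    \<Rightarrow> (nat \<Rightarrow> rbq mat set) \<Rightarrow> rbq mat list set" where
  "N_LE r m t A B E L =
     {Xs. is_arg_min (\<lambda>Ys. fro_norm (residual r m t A B E Ys)) (\<lambda>Ys. Ys \<in> feasible_tuples r L) Xs}"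

definition coord_vec :: "rbq mat list \<Rightarrow> real vec" where
  "coord_vec Xs = vconcat (map (\<lambda>X. vec_of_mat (real_rep X)) Xs)"

end

theory Submission
  imports Defs
begin

text \<open>
  In coordinates the problem is an ordinary real least squares problem. A tuple lies in the
  structures iff its coordinate vector is \<open>T *\<^sub>v y\<close> for some real \<open>y\<close>. Moreover
  \<open>vec (Psi (A X B))\<close> is a complex matrix applied to the coordinates of \<open>X\<close>
  (\<open>vec_Psi_product\<close>, \<open>W_mat_mult_real_rep\<close>), and \<open>Psi\<close> preserves the Frobenius norm. Separating
  real and imaginary parts, the squared residual norm is therefore the squared length of
  \<open>G *\<^sub>v y - e\<close>, where \<open>G\<close> is \<open>Q1\<close> stacked on \<open>Q2\<close> (\<open>fro_norm_residual\<close>).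

  If \<open>C\<close> is a pseudo-inverse of \<open>G\<close>, then \<open>G *\<^sub>v y - e\<close> splits into the orthogonal parts
  \<open>G *\<^sub>v (y - C *\<^sub>v e)\<close> and \<open>G *\<^sub>v (C *\<^sub>v e) - e\<close>, so the minimizers are the vectors
  \<open>C *\<^sub>v e + (1 - C G) *\<^sub>v z\<close> (\<open>least_squares_solutions\<close>). What remains is that the explicit \<open>C\<close> is
  a pseudo-inverse of \<open>G\<close>, with \<open>1 - C G = P\<close>. This is Cline's formula for the pseudo-inverse of
  a partitioned matrix (\<open>pseudo_inverse_append_rows\<close>), verified through the Penrose equations.

  In coordinates the minimizers form an affine space \<open>c + J *\<^sub>v z\<close> with \<open>c = T C e\<close> and \<open>J = T P\<close>.
  Finding the shortest one is a least squares problem for \<open>J\<close>, and in such a problem the fitted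
  vector \<open>J *\<^sub>v z\<close> is unique. As a tuple is determined by its coordinate vector, this gives
  existence and uniqueness. If the basis matrices have orthonormal columns, \<open>T\<close> is an isometry,
  so \<open>P C = 0\<close> makes \<open>c\<close> orthogonal to the range of \<open>J\<close>, and the shortest vector is \<open>c\<close> itself.
\<close>

section \<open>Matrix algebra with dimensions as side conditions\<close>

text \<open>The ring laws for matrices are stated with conditions on \<open>dim_row\<close> and \<open>dim_col\<close>, which the
  simplifier can discharge. With membership in \<open>carrier_mat\<close> as premise, the dimensions would be
  extra variables that rewriting cannot instantiate.\<close>

lemma mat_mult_assoc_dim:
  fixes A B C :: "'a::semiring_0 mat"
  shows "dim_col A = dim_row B \<Longrightarrow> dim_col B = dim_row C \<Longrightarrow> A * B * C = A * (B * C)"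
  by (metis assoc_mult_mat carrier_matI)

lemma mat_distrib_dim:
  fixes A B C :: "'a::ring mat"
  shows "dim_row A = dim_row B \<Longrightarrow> dim_col A = dim_col B \<Longrightarrow> dim_col B = dim_row C \<Longrightarrow>
      (A + B) * C = A * C + B * C"
    and "dim_row A = dim_row B \<Longrightarrow> dim_col A = dim_col B \<Longrightarrow> dim_col B = dim_row C \<Longrightarrow>
      (A - B) * C = A * C - B * C"
    and "dim_row B = dim_row C \<Longrightarrow> dim_col B = dim_col C \<Longrightarrow> dim_col A = dim_row B \<Longrightarrow>
      A * (B + C) = A * B + A * C"
    and "dim_row B = dim_row C \<Longrightarrow> dim_col B = dim_col C \<Longrightarrow> dim_col A = dim_row B \<Longrightarrow>
      A * (B - C) = A * B - A * C"
  by (metis add_mult_distrib_mat carrier_matI, metis minus_mult_distrib_mat carrier_matI,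
      metis mult_add_distrib_mat carrier_matI, metis mult_minus_distrib_mat carrier_matI)

lemma mat_transpose_dim:
  fixes A B :: "'a::comm_ring_1 mat"
  shows "dim_col A = dim_row B \<Longrightarrow> transpose_mat (A * B) = transpose_mat B * transpose_mat A"
    and "dim_row A = dim_row B \<Longrightarrow> dim_col A = dim_col B \<Longrightarrow>
      transpose_mat (A + B) = transpose_mat A + transpose_mat B"
    and "dim_row A = dim_row B \<Longrightarrow> dim_col A = dim_col B \<Longrightarrow>
      transpose_mat (A - B) = transpose_mat A - transpose_mat B"
  by (metis transpose_mult carrier_matI, auto intro!: eq_matI)

lemma mat_one_zero_dim:
  fixes A :: "'a::ring_1 mat"
  shows "dim_row A = n \<Longrightarrow> 1\<^sub>m n * A = A"
    and "dim_col A = n \<Longrightarrow> A * 1\<^sub>m n = A"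
    and "dim_row A = n \<Longrightarrow> 0\<^sub>m k n * A = 0\<^sub>m k (dim_col A)"
    and "dim_col A = n \<Longrightarrow> A * 0\<^sub>m n k = 0\<^sub>m (dim_row A) k"
    and "dim_row A = n \<Longrightarrow> dim_col A = k \<Longrightarrow> A - 0\<^sub>m n k = A"
    and "dim_row A = n \<Longrightarrow> dim_col A = k \<Longrightarrow> A + 0\<^sub>m n k = A"
    and "dim_row A = n \<Longrightarrow> dim_col A = k \<Longrightarrow> 0\<^sub>m n k + A = A"
    and "dim_row A = n \<Longrightarrow> dim_col A = k \<Longrightarrow> A - A = 0\<^sub>m n k"
  by (metis left_mult_one_mat carrier_matI, metis right_mult_one_mat carrier_matI,
      auto intro!: eq_matI)

lemmas mat_algebra = mat_mult_assoc_dim mat_distrib_dim mat_transpose_dim mat_one_zero_dim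

lemma mat_mult_index:
  assumes "i < dim_row A" "j < dim_col B" "dim_col A = dim_row B"
  shows "(A * B) $$ (i, j) = (\<Sum>k<dim_row B. A $$ (i, k) * B $$ (k, j))"
  using assms by (simp add: scalar_prod_def atLeast0LessThan)

section \<open>Moore-Penrose inverses\<close>

text \<open>Write \<open>A = Q D\<close> with \<open>Q\<close> invertible and \<open>D\<close> in reduced row echelon form. The pivot columns of
  \<open>D\<close> are unit vectors, so a 0-1 matrix \<open>V\<close> that selects them makes \<open>D V\<close> the identity on the
  nonzero rows, whence \<open>D V D = D\<close>.\<close>

lemma exists_generalized_inverse:
  fixes A :: "'a::field mat"
  shows "\<exists>W\<in>carrier_mat (dim_col A) (dim_row A). A * W * A = A"
proof -
  define nr nc where "nr = dim_row A" and "nc = dim_col A"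
  have A: "A \<in> carrier_mat nr nc" by (simp add: nr_def nc_def)
  obtain D where D: "gauss_jordan_single A = D" by blast
  note gj = gauss_jordan_single[OF A D]
  obtain P Q where PQ: "D = P * A" "P \<in> carrier_mat nr nr" "Q \<in> carrier_mat nr nr"
    "Q * P = 1\<^sub>m nr" using gj(4) by blast
  have Dc: "D \<in> carrier_mat nr nc" by (rule gj(2))
  obtain f where f: "pivot_fun D f nc"
    using gj(3) Dc unfolding row_echelon_form_def by auto
  note pf = pivot_funD[OF _ f, of nr]
  define V where "V = mat nc nr (\<lambda>(j, i). if f i = j then 1 else 0 :: 'a)"
  have Vc: "V \<in> carrier_mat nc nr" by (simp add: V_def)
  have DV: "(D * V) $$ (k, i) = (if f i < nc \<and> k = i then 1 else 0)" if "k < nr" "i < nr" for k i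
  proof -
    have "(D * V) $$ (k, i) = (\<Sum>j<nc. D $$ (k, j) * (if f i = j then 1 else 0))"
      using that Dc by (subst mat_mult_index) (auto simp: V_def)
    also have "\<dots> = (if f i < nc then D $$ (k, f i) else 0)"
      by (simp add: if_distrib[where f = "\<lambda>x. _ * x"] cong: if_cong)
    also have "\<dots> = (if f i < nc \<and> k = i then 1 else 0)"
      using pf(4)[of i] pf(5)[of i k] that Dc by auto
    finally show ?thesis .
  qed
  have zero_row: "D $$ (k, j) = 0" if "k < nr" "\<not> f k < nc" "j < nc" for k j
    using pf(1)[of k] pf(2)[of k j] that Dc by auto
  have "D * V * D = D"
  proof (rule eq_matI)
    fix k j assume "k < dim_row D" "j < dim_col D"
    then have kj: "k < nr" "j < nc" using Dc by auto
    have "(D * V * D) $$ (k, j) = (\<Sum>i<nr. (D * V) $$ (k, i) * D $$ (i, j))"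
      using kj Dc Vc by (subst mat_mult_index) auto
    also have "\<dots> = (\<Sum>i<nr. if k = i then (if f k < nc then D $$ (k, j) else 0) else 0)"
      by (rule sum.cong) (auto simp: DV kj)
    also have "\<dots> = D $$ (k, j)"
      using zero_row[of k j] kj by simp
    finally show "(D * V * D) $$ (k, j) = D $$ (k, j)" .
  qed (use Dc Vc in auto)
  moreover have QD: "Q * D = A"
    unfolding PQ(1) using assoc_mult_mat[OF PQ(3,2) A] PQ(4) A by simp
  ultimately have "A * (V * P) * A = A"
  proof -
    have "A * (V * P) * A = Q * D * (V * (P * A))"
      using PQ(2) A Vc QD Dc by (simp add: mat_mult_assoc_dim)
    also have "\<dots> = Q * (D * V * D)"
      unfolding PQ(1)[symmetric] using PQ(3) Vc Dc by (simp add: mat_mult_assoc_dim)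
    finally show ?thesis using \<open>D * V * D = D\<close> QD by simp
  qed
  then show ?thesis
    using PQ(2) Vc by (intro bexI[of _ "V * P"]) (auto simp: nr_def nc_def)
qed

lemma sq_norm_zero_iff:
  fixes v :: "real vec"
  shows "v \<bullet> v = 0 \<longleftrightarrow> v = 0\<^sub>v (dim_vec v)"
  using conjugate_square_eq_0_vec[OF carrier_vecI[OF refl], of v] by (simp only: vec_conjugate_real)

lemma sq_norm_ge_0: "(v :: real vec) \<bullet> v \<ge> 0"
  using conjugate_square_ge_0_vec[of v] by (simp only: vec_conjugate_real)

lemma gram_zero_imp_zero:
  fixes X :: "real mat"
  assumes "transpose_mat X * X = 0\<^sub>m (dim_col X) (dim_col X)"
  shows "X = 0\<^sub>m (dim_row X) (dim_col X)"
proof (rule eq_matI)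
  fix i j assume "i < dim_row (0\<^sub>m (dim_row X) (dim_col X))" "j < dim_col (0\<^sub>m (dim_row X) (dim_col X))"
  then have ij: "i < dim_row X" "j < dim_col X" by auto
  have "col X j \<bullet> col X j = (transpose_mat X * X) $$ (j, j)" using ij by simp
  also have "\<dots> = 0" unfolding assms using ij by simp
  finally have "col X j = 0\<^sub>v (dim_row X)" unfolding sq_norm_zero_iff by simp
  then show "X $$ (i, j) = 0\<^sub>m (dim_row X) (dim_col X) $$ (i, j)"
    using ij by (metis index_col index_zero_mat(1) index_zero_vec(1))
qed auto

text \<open>With \<open>D = X - Y\<close>, the equation \<open>A\<^sup>T A D = 0\<close> over the reals forces \<open>(A D)\<^sup>T (A D) = 0\<close> and hence \<open>A D = 0\<close>.\<close>

lemma gram_cancel: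
  fixes A X Y :: "real mat"
  assumes d: "dim_row X = dim_col A" "dim_row Y = dim_col A" "dim_col X = dim_col Y"
    and eq: "transpose_mat A * A * X = transpose_mat A * A * Y"
  shows "A * X = A * Y"
proof -
  let ?D = "X - Y"
  have "transpose_mat A * (A * ?D) = transpose_mat A * A * X - transpose_mat A * A * Y"
    using d by (simp add: mat_algebra)
  also have "\<dots> = 0\<^sub>m (dim_col A) (dim_col Y)"
    unfolding eq by (rule mat_one_zero_dim(8)) (simp_all add: d)
  finally have 0: "transpose_mat A * (A * ?D) = 0\<^sub>m (dim_col A) (dim_col Y)" .
  have "transpose_mat (A * ?D) * (A * ?D) = transpose_mat ?D * (transpose_mat A * (A * ?D))"
    using d by (simp add: mat_transpose_dim(1) mat_mult_assoc_dim)
  also have "\<dots> = 0\<^sub>m (dim_col (A * ?D)) (dim_col (A * ?D))"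
    unfolding 0 using d by (simp add: mat_one_zero_dim)
  finally have "A * ?D = 0\<^sub>m (dim_row A) (dim_col Y)"
    using gram_zero_imp_zero[of "A * ?D"] d by simp
  then have D0: "A * X - A * Y = 0\<^sub>m (dim_row A) (dim_col Y)"
    using d by (simp add: mat_distrib_dim)
  show ?thesis
  proof (rule eq_matI)
    fix i j assume ij: "i < dim_row (A * Y)" "j < dim_col (A * Y)"
    have "(A * X - A * Y) $$ (i, j) = 0" unfolding D0 using ij by simp
    then show "(A * X) $$ (i, j) = (A * Y) $$ (i, j)" using ij d by simp
  qed (use d in auto)
qed

text \<open>Solving the normal equations: if \<open>W\<close> is any generalized inverse of \<open>A\<^sup>T A\<close>, then
  \<open>A W A\<^sup>T\<close> is the orthogonal projection onto the column space of \<open>A\<close>. The two equations are the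
  first and the third Penrose equation; both follow by cancelling \<open>A\<^sup>T\<close>.\<close>

lemma exists_13_inverse:
  fixes A :: "real mat"
  shows "\<exists>X\<in>carrier_mat (dim_col A) (dim_row A).
    A * X * A = A \<and> transpose_mat (A * X) = A * X"
proof -
  obtain W where W: "W \<in> carrier_mat (dim_col A) (dim_col A)"
    "transpose_mat A * A * W * (transpose_mat A * A) = transpose_mat A * A"
    using exists_generalized_inverse[of "transpose_mat A * A"] by auto
  let ?X = "W * transpose_mat A"
  have 1: "A * (?X * A) = A * 1\<^sub>m (dim_col A)"
    by (rule gram_cancel) (use W in \<open>simp_all add: mat_mult_assoc_dim mat_one_zero_dim\<close>)
  then have AXA: "A * ?X * A = A" using W by (simp add: mat_mult_assoc_dim mat_one_zero_dim)
  have "transpose_mat A = transpose_mat (A * ?X * A)" using AXA by simp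
  also have "\<dots> = transpose_mat A * (A * (transpose_mat W * transpose_mat A))"
    using W(1) by (simp add: mat_transpose_dim mat_mult_assoc_dim)
  finally have t: "transpose_mat A = transpose_mat A * (A * (transpose_mat W * transpose_mat A))" .
  have "transpose_mat A * A * (W * transpose_mat A) = transpose_mat A * A * W * transpose_mat A"
    using W(1) by (simp add: mat_mult_assoc_dim)
  also have "\<dots> = transpose_mat A * A * W * (transpose_mat A * (A * (transpose_mat W * transpose_mat A)))"
    by (rule arg_cong[OF t])
  also have "\<dots> = (transpose_mat A * A * W * (transpose_mat A * A)) * (transpose_mat W * transpose_mat A)"
    using W(1) by (simp add: mat_mult_assoc_dim)
  also have "\<dots> = transpose_mat A * A * (transpose_mat W * transpose_mat A)"
    by (simp only: W(2))
  finally have eq: "transpose_mat A * A * (W * transpose_mat A)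
      = transpose_mat A * A * (transpose_mat W * transpose_mat A)" .
  have "A * (W * transpose_mat A) = A * (transpose_mat W * transpose_mat A)"
    by (rule gram_cancel[OF _ _ _ eq]) (use W(1) in simp_all)
  moreover have "transpose_mat (A * ?X) = A * (transpose_mat W * transpose_mat A)"
    using W(1) by (simp add: mat_transpose_dim mat_mult_assoc_dim)
  ultimately show ?thesis using AXA W(1) by (intro bexI[of _ ?X]) auto
qed

text \<open>\<open>A X\<close> and \<open>A Y\<close> are both the orthogonal projection onto the column space of \<open>A\<close>, and \<open>X A\<close> and
  \<open>Y A\<close> are both the one onto its row space. Hence \<open>X = X A X = X A Y = Y A Y = Y\<close>.\<close>

lemma pseudo_inverse_unique:
  assumes X: "is_pseudo_inverse A X" and Y: "is_pseudo_inverse A Y"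
  shows "X = Y"
proof -
  note x = X[unfolded is_pseudo_inverse_def] and y = Y[unfolded is_pseudo_inverse_def]
  have d: "dim_row X = dim_col A" "dim_col X = dim_row A" "dim_row Y = dim_col A" "dim_col Y = dim_row A"
    using x y by auto
  have "A * X = transpose_mat (A * Y * (A * X))"
  proof -
    have "A * Y * (A * X) = A * Y * A * X" using d by (simp add: mat_mult_assoc_dim)
    then have "A * Y * (A * X) = A * X" using y by simp
    then show ?thesis using x by simp
  qed
  also have "\<dots> = A * X * (A * Y)" using x y d by (simp add: mat_transpose_dim(1)[of "A * Y" "A * X"])
  also have "\<dots> = A * X * A * Y" using d by (simp add: mat_mult_assoc_dim)
  also have "\<dots> = A * Y" using x by simp
  finally have 1: "A * X = A * Y" .
  have "X * A = transpose_mat (X * A * (Y * A))"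
  proof -
    have "X * A * (Y * A) = X * (A * Y * A)" using d by (simp add: mat_mult_assoc_dim)
    then have "X * A * (Y * A) = X * A" using y by simp
    then show ?thesis using x by simp
  qed
  also have "\<dots> = Y * A * (X * A)" using x y d by (simp add: mat_transpose_dim(1)[of "X * A" "Y * A"])
  also have "\<dots> = Y * (A * X * A)" using d by (simp add: mat_mult_assoc_dim)
  also have "\<dots> = Y * A" using x by simp
  finally have 2: "X * A = Y * A" .
  have "X = X * (A * X)" using x d by (simp add: mat_mult_assoc_dim)
  also have "\<dots> = X * A * Y" using 1 d by (simp add: mat_mult_assoc_dim)
  also have "\<dots> = Y" using 2 y by simp
  finally show ?thesis .
qed

text \<open>With \<open>X\<close> such that \<open>A X\<close> is the orthogonal projection onto the column space, and \<open>Y\<close> such that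
  \<open>Y A\<close> is the one onto the row space, the product \<open>Y A X\<close> induces both projections.\<close>

lemma exists_pseudo_inverse: "\<exists>X. is_pseudo_inverse A X"
proof -
  obtain X where X: "X \<in> carrier_mat (dim_col A) (dim_row A)"
    "A * X * A = A" "transpose_mat (A * X) = A * X"
    using exists_13_inverse[of A] by blast
  obtain Y' where Y': "Y' \<in> carrier_mat (dim_row A) (dim_col A)"
    "transpose_mat A * Y' * transpose_mat A = transpose_mat A"
    "transpose_mat (transpose_mat A * Y') = transpose_mat A * Y'"
    using exists_13_inverse[of "transpose_mat A"] by auto
  define Y where "Y = transpose_mat Y'"
  have Y: "Y \<in> carrier_mat (dim_col A) (dim_row A)" using Y'(1) by (simp add: Y_def)
  have YA: "Y * A = transpose_mat A * Y'"
    using Y'(1,3) by (simp add: Y_def mat_transpose_dim)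
  have YAs: "transpose_mat (Y * A) = Y * A" using Y'(3) YA by simp
  have AYA: "A * Y * A = A"
  proof -
    have "transpose_mat (A * Y * A) = transpose_mat A"
      using Y'(1,2) by (simp add: Y_def mat_transpose_dim mat_mult_assoc_dim)
    then show ?thesis by simp
  qed
  let ?P = "Y * A * X"
  have r: "A * (X * A) = A" "A * (Y * A) = A"
    using X(1,2) Y AYA by (simp_all add: mat_mult_assoc_dim)
  have AP: "A * ?P = A * X"
  proof -
    have "A * ?P = A * Y * A * X" using X(1) Y by (simp add: mat_mult_assoc_dim)
    then show ?thesis by (simp only: AYA)
  qed
  have PA: "?P * A = Y * A"
    using X(1) Y r by (simp add: mat_mult_assoc_dim)
  have "is_pseudo_inverse A ?P"
    unfolding is_pseudo_inverse_def PA unfolding AP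
    using X Y YAs AP r(1) by (auto simp: mat_mult_assoc_dim)
  then show ?thesis ..
qed

lemma is_pseudo_inverse_pinv: "is_pseudo_inverse A (pinv A)"
  unfolding pinv_def using exists_pseudo_inverse pseudo_inverse_unique by (metis theI)

lemma pinv_dims [simp]: "dim_row (pinv A) = dim_col A" "dim_col (pinv A) = dim_row A"
  using is_pseudo_inverse_pinv[of A] unfolding is_pseudo_inverse_def by auto

section \<open>The pseudo-inverse of two stacked matrices\<close>

lemma pinv_eqs:
  "A * pinv A * A = A" "pinv A * A * pinv A = pinv A"
  "transpose_mat (A * pinv A) = A * pinv A" "transpose_mat (pinv A * A) = pinv A * A"
  using is_pseudo_inverse_pinv[of A] unfolding is_pseudo_inverse_def by auto

lemma append_rows_dims [simp]:
  "dim_row (A @\<^sub>r B) = dim_row A + dim_row B" "dim_col (A @\<^sub>r B) = dim_col A"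
  by (simp_all add: append_rows_def)

lemma append_cols_dims [simp]:
  "dim_row (append_cols A B) = dim_row A" "dim_col (append_cols A B) = dim_col A + dim_col B"
  by (simp_all add: append_cols_def)

lemma append_rows_times_append_cols:
  fixes A B C D :: "'a::ring_1 mat"
  assumes "A \<in> carrier_mat a d" "B \<in> carrier_mat b d" "C \<in> carrier_mat d p" "D \<in> carrier_mat d q"
  shows "(A @\<^sub>r B) * append_cols C D = four_block_mat (A * C) (A * D) (B * C) (B * D)"
proof -
  have "(A @\<^sub>r B) * append_cols C D = four_block_mat
      (A * C + 0\<^sub>m a 0 * 0\<^sub>m 0 p) (A * D + 0\<^sub>m a 0 * 0\<^sub>m 0 q)
      (B * C + 0\<^sub>m b 0 * 0\<^sub>m 0 p) (B * D + 0\<^sub>m b 0 * 0\<^sub>m 0 q)"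
    unfolding append_rows_def append_cols_def using assms
    by (subst mult_four_block_mat[where ?n1.0 = d and ?n2.0 = 0]) auto
  then show ?thesis using assms by (simp add: mat_one_zero_dim)
qed

lemma append_cols_times_append_rows:
  fixes A B C D :: "'a::ring_1 mat"
  assumes "A \<in> carrier_mat a d" "B \<in> carrier_mat b d" "C \<in> carrier_mat d a" "D \<in> carrier_mat d b"
  shows "append_cols C D * (A @\<^sub>r B) = C * A + D * B"
proof -
  have "append_cols C D * (A @\<^sub>r B) = four_block_mat (C * A + D * B) (C * 0\<^sub>m a 0 + D * 0\<^sub>m b 0)
      (0\<^sub>m 0 a * A + 0\<^sub>m 0 b * B) (0\<^sub>m 0 a * 0\<^sub>m a 0 + 0\<^sub>m 0 b * 0\<^sub>m b 0)"
    unfolding append_rows_def append_cols_def using assms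
    by (subst mult_four_block_mat[where ?n1.0 = a and ?n2.0 = b]) auto
  also have "\<dots> = C * A + D * B"
    using assms by (intro eq_matI) auto
  finally show ?thesis .
qed

lemma append_rows_times:
  fixes A B D :: "'a::ring_1 mat"
  assumes "A \<in> carrier_mat a d" "B \<in> carrier_mat b d" "D \<in> carrier_mat d k"
  shows "(A @\<^sub>r B) * D = (A * D) @\<^sub>r (B * D)"
  using assms unfolding append_rows_def
  by (intro eq_matI) (auto simp: scalar_prod_def)

lemma times_append_cols:
  fixes C D E :: "'a::ring_1 mat"
  assumes "E \<in> carrier_mat k d" "C \<in> carrier_mat d a" "D \<in> carrier_mat d b"
  shows "E * append_cols C D = append_cols (E * C) (E * D)"
  using assms unfolding append_cols_def
  by (intro eq_matI) (auto simp: scalar_prod_def)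

text \<open>If \<open>V v = 0\<close>, then \<open>v \<bullet> V v\<close> is the sum of the squared lengths of \<open>v\<close> and \<open>Y\<^sup>T v\<close>, so
  \<open>v = 0\<close>. This is the reason why the inverse in Cline's formula exists.\<close>

lemma one_plus_gram_inverse:
  fixes Y :: "real mat"
  assumes Y: "Y \<in> carrier_mat n k"
  defines "V \<equiv> 1\<^sub>m n + Y * transpose_mat Y"
  shows "inv_mat V \<in> carrier_mat n n" "V * inv_mat V = 1\<^sub>m n" "inv_mat V * V = 1\<^sub>m n"
proof -
  have V: "V \<in> carrier_mat n n" using Y by (simp add: V_def)
  have inj: "v = 0\<^sub>v n" if v: "v \<in> carrier_vec n" and 0: "V *\<^sub>v v = 0\<^sub>v n" for v
  proof -
    let ?w = "transpose_mat Y *\<^sub>v v"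
    have "V *\<^sub>v v = v + Y *\<^sub>v ?w"
      unfolding V_def using Y v by (simp add: add_mult_distrib_mat_vec[of _ n n])
    then have "v \<bullet> (V *\<^sub>v v) = v \<bullet> v + v \<bullet> (Y *\<^sub>v ?w)"
      using Y v by (simp add: scalar_prod_add_distrib[of _ n])
    also have "v \<bullet> (Y *\<^sub>v ?w) = ?w \<bullet> ?w"
      using Y v by (simp add: transpose_vec_mult_scalar[of Y n k])
    finally have "v \<bullet> v + ?w \<bullet> ?w = 0" using 0 v by simp
    then have "v \<bullet> v = 0" using sq_norm_ge_0[of v] sq_norm_ge_0[of ?w] by linarith
    then show ?thesis using v unfolding sq_norm_zero_iff by auto
  qed
  have "det V \<noteq> 0"
    unfolding det_0_iff_vec_prod_zero_field[OF V] using inj by blast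
  from det_non_zero_imp_unit[OF V this, where b = "()"] obtain W where W: "mat_inverse V = Some W"
    using mat_inverse(1)[OF V, where b = "()"] by (cases "mat_inverse V") auto
  then show "inv_mat V \<in> carrier_mat n n" "V * inv_mat V = 1\<^sub>m n" "inv_mat V * V = 1\<^sub>m n"
    using mat_inverse(2)[OF V W] by (simp_all add: inv_mat_def)
qed

text \<open>Cline's formula, transposed from columns to rows. The columns of \<open>R\<close> are the components of the
  rows of \<open>B\<close> that are orthogonal to the row space of \<open>A\<close>. Hence the row space of the stacked
  matrix is the orthogonal sum of the row space of \<open>A\<close> and the column space of \<open>R\<close>, which explains the
  projection \<open>pinv A * A + R * pinv R\<close>. The summand of \<open>H\<close> involving \<open>Z\<close> acts on the
  combinations of rows of \<open>B\<close> that lie in the row space of \<open>A\<close>; it makes the product of the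
  stacked matrix with \<open>C\<close> symmetric.\<close>

lemma pseudo_inverse_append_rows:
  fixes A B R Z H C :: "real mat"
  assumes A: "A \<in> carrier_mat a d" and B: "B \<in> carrier_mat b d"
    and R_eq: "R = (1\<^sub>m d - pinv A * A) * transpose_mat B"
    and Z_eq: "Z = inv_mat (1\<^sub>m b
           + (1\<^sub>m b - pinv R * R) * B * pinv A * transpose_mat (pinv A)
             * transpose_mat B * (1\<^sub>m b - pinv R * R))"
    and H_eq: "H = pinv R
           + (1\<^sub>m b - pinv R * R) * Z * B * pinv A * transpose_mat (pinv A)
             * (1\<^sub>m d - transpose_mat B * pinv R)"
    and C_eq: "C = append_cols (pinv A - transpose_mat H * B * pinv A) (transpose_mat H)"
  shows "C \<in> carrier_mat d (a + b)"
    and "C * (A @\<^sub>r B) = pinv A * A + R * pinv R"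
    and "is_pseudo_inverse (A @\<^sub>r B) C"
proof -
  define D K where "D = pinv A" and "K = pinv R"
  define U F where "U = D * A" and "F = 1\<^sub>m b - K * R"
  \<comment> \<open>\<open>U\<close> projects onto the row space of \<open>A\<close>, \<open>F\<close> onto the kernel of \<open>R\<close>, and \<open>X\<close> is the Gram matrix
      whose sum with the identity is inverted by \<open>Z\<close>.\<close>
  define X where "X = F * B * D * transpose_mat (F * B * D)"
  have dA [simp]: "dim_row A = a" "dim_col A = d" using A by auto
  have dB [simp]: "dim_row B = b" "dim_col B = d" using B by auto
  have dD [simp]: "dim_row D = d" "dim_col D = a" by (simp_all add: D_def)
  have dR [simp]: "dim_row R = d" "dim_col R = b" by (simp_all add: R_eq)
  have dK [simp]: "dim_row K = b" "dim_col K = d" by (simp_all add: K_def)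
  have dP [simp]: "dim_row U = d" "dim_col U = d" by (simp_all add: U_def)
  have dF [simp]: "dim_row F = b" "dim_col F = b" by (simp_all add: F_def)
  have dX [simp]: "dim_row X = b" "dim_col X = b" by (simp_all add: X_def)
  note alg = mat_algebra
  note penA = pinv_eqs[of A, folded D_def, folded U_def] and penR = pinv_eqs[of R, folded K_def]
  have Ut: "transpose_mat U = U" by (rule penA(4))
  have AU: "A * U = A" using penA(1) by (simp add: U_def alg)
  have UD: "U * D = D" by (rule penA(2))
  have UU: "U * U = U"
  proof -
    have "U * U = U * D * A" by (subst (2) U_def) (simp add: mat_mult_assoc_dim)
    then show ?thesis by (simp add: UD U_def[symmetric])
  qed
  have R: "R = (1\<^sub>m d - U) * transpose_mat B" by (simp add: R_eq U_def D_def)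
  have Rt: "transpose_mat R = B - B * U" unfolding R by (simp add: alg Ut)
  \<comment> \<open>The range of \<open>R\<close> is orthogonal to the row space of \<open>A\<close>. As the row space
      of \<open>K\<close> is the range of \<open>R\<close>, the products \<open>K * U\<close>, \<open>K * D\<close> and \<open>K * A\<^sup>T\<close> vanish as well.\<close>
  have UR: "U * R = 0\<^sub>m d b"
  proof -
    have "U * R = (U - U * U) * transpose_mat B"
      unfolding R by (simp add: mat_mult_assoc_dim[symmetric]) (simp add: alg)
    then show ?thesis by (simp add: UU alg)
  qed
  have KRK: "K * R * K = K" and RKR: "R * K * R = R" and RKt: "transpose_mat (R * K) = R * K"
    and KRt: "transpose_mat (K * R) = K * R" using penR by simp_all
  have AR: "A * R = 0\<^sub>m a b"
  proof -
    have "A * R = A * (U * R)" using AU by (simp add: mat_mult_assoc_dim[symmetric])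
    then show ?thesis by (simp add: UR alg)
  qed
  have RKU: "R * K * U = 0\<^sub>m d d"
  proof -
    have "transpose_mat (U * (R * K)) = R * K * U"
      using RKt by (simp add: mat_transpose_dim(1)[of U] Ut)
    moreover have "U * (R * K) = U * R * K" by (simp add: alg)
    ultimately show ?thesis by (simp add: UR alg)
  qed
  have KU: "K * U = 0\<^sub>m b d"
  proof -
    have "K * U = K * (R * K * U)" by (subst (1) KRK[symmetric]) (simp add: alg)
    then show ?thesis by (simp add: RKU alg)
  qed
  have KD: "K * D = 0\<^sub>m b a"
  proof -
    have "K * D = K * U * D" by (subst (1) UD[symmetric]) (simp add: alg)
    then show ?thesis by (simp add: KU alg)
  qed
  have KAt: "K * transpose_mat A = 0\<^sub>m b a"
  proof -
    have "transpose_mat A = U * transpose_mat A"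
      by (subst (1) AU[symmetric]) (simp add: mat_transpose_dim Ut)
    then have "K * transpose_mat A = K * U * transpose_mat A" by (simp add: alg)
    then show ?thesis by (simp add: KU alg)
  qed
  have KBt: "K * transpose_mat B = K * R"
  proof -
    have "K * R = K * transpose_mat B - K * U * transpose_mat B" unfolding R by (simp add: alg)
    then show ?thesis by (simp add: KU alg)
  qed
  have Ft: "transpose_mat F = F" unfolding F_def using KRt by (simp add: mat_transpose_dim(3))
  have RF: "R * F = 0\<^sub>m d b" unfolding F_def using RKR by (simp add: alg)
  have KRKR: "K * R * (K * R) = K * R" using KRK by (simp add: mat_mult_assoc_dim[symmetric])
  have FKR: "F * (K * R) = 0\<^sub>m b b"
    unfolding F_def using KRKR by (simp add: mat_distrib_dim mat_one_zero_dim)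
  \<comment> \<open>\<open>F\<close> commutes with \<open>Z\<close>, because \<open>X\<close> vanishes on the range of the projection \<open>K * R\<close>,
      so that \<open>Z\<close> is the identity there. Hence \<open>F * Z = Z * F = Z - K * R\<close>.\<close>
  have X_eq: "X = F * B * D * transpose_mat D * transpose_mat B * F"
    unfolding X_def by (simp add: alg Ft)
  have ZX: "Z = inv_mat (1\<^sub>m b + X)"
    unfolding X_eq Z_eq F_def K_def D_def ..
  have FBD: "F * B * D \<in> carrier_mat b a" by (auto intro: carrier_matI)
  note Zinv = one_plus_gram_inverse[OF FBD, folded X_def ZX]
  have dZ [simp]: "dim_row Z = b" "dim_col Z = b" using Zinv(1) by auto
  have Xt: "transpose_mat X = X" unfolding X_def by (simp add: alg)
  have Zt: "transpose_mat Z = Z"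
  proof -
    have "transpose_mat Z * (1\<^sub>m b + X) = transpose_mat ((1\<^sub>m b + X) * Z)"
      by (simp add: mat_transpose_dim Xt)
    also have "\<dots> = 1\<^sub>m b" using Zinv(2) by simp
    finally have 1: "transpose_mat Z * (1\<^sub>m b + X) = 1\<^sub>m b" .
    have "transpose_mat Z = transpose_mat Z * ((1\<^sub>m b + X) * Z)"
      using Zinv(2) by (simp add: mat_one_zero_dim)
    also have "\<dots> = transpose_mat Z * (1\<^sub>m b + X) * Z"
      by (simp add: mat_mult_assoc_dim)
    also have "\<dots> = Z" unfolding 1 by (simp add: mat_one_zero_dim)
    finally show ?thesis .
  qed
  have ZKR: "Z * (K * R) = K * R"
  proof -
    have "X * (K * R) = 0\<^sub>m b b"
      unfolding X_eq using FKR by (simp add: mat_mult_assoc_dim mat_one_zero_dim)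
    then have "K * R = (1\<^sub>m b + X) * (K * R)" by (simp add: mat_distrib_dim mat_one_zero_dim)
    then have "Z * (K * R) = Z * (1\<^sub>m b + X) * (K * R)"
      by (metis mat_mult_assoc_dim dZ dX dK dR index_mult_mat(2,3) index_add_mat(2,3) index_one_mat(2,3))
    then show ?thesis using Zinv(3) by (simp add: mat_one_zero_dim)
  qed
  have KRZ: "K * R * Z = K * R"
    using arg_cong[OF ZKR, of transpose_mat] KRt Zt by (simp add: mat_transpose_dim(1)[of Z])
  have FZ: "F * Z = Z - K * R" unfolding F_def using KRZ by (simp add: mat_distrib_dim mat_one_zero_dim)
  have ZF: "Z * F = Z - K * R" unfolding F_def using ZKR by (simp add: mat_distrib_dim mat_one_zero_dim)
  have ZX1: "Z * X = 1\<^sub>m b - Z"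
  proof -
    have "Z + Z * X = 1\<^sub>m b" using Zinv(3) by (simp add: mat_distrib_dim mat_one_zero_dim)
    moreover have "Z * X = (Z + Z * X) - Z" by (intro eq_matI) auto
    ultimately show ?thesis by simp
  qed
  \<comment> \<open>\<open>G\<close> is the second summand of \<open>H\<close>. It is killed by \<open>R\<close>, and its products with the transposes
      of \<open>A\<close> and \<open>B\<close> collapse to expressions in \<open>Z\<close>, because \<open>Z * X = 1 - Z\<close>.\<close>
  define G where "G = F * (Z * (B * (D * (transpose_mat D * (1\<^sub>m d - transpose_mat B * K)))))"
  have dG [simp]: "dim_row G = b" "dim_col G = d" by (simp_all add: G_def)
  have H: "H = K + G"
    unfolding H_eq G_def K_def[symmetric] D_def[symmetric] F_def[symmetric]
    by (simp add: mat_mult_assoc_dim)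
  have dH [simp]: "dim_row H = b" "dim_col H = d" by (simp_all add: H)
  have RH: "R * H = R * K"
  proof -
    have "R * G = R * F * (Z * (B * (D * (transpose_mat D * (1\<^sub>m d - transpose_mat B * K)))))"
      unfolding G_def by (simp add: mat_mult_assoc_dim)
    then show ?thesis unfolding H by (simp add: RF mat_distrib_dim mat_one_zero_dim)
  qed
  have G_times: "G * Y = F * (Z * (B * (D * (transpose_mat D * (Y - transpose_mat B * (K * Y))))))"
    if "dim_row Y = d" for Y
    unfolding G_def using that by (simp add: mat_mult_assoc_dim mat_distrib_dim mat_one_zero_dim)
  have HAt: "H * transpose_mat A = F * Z * B * D"
  proof -
    have "transpose_mat D * transpose_mat A = A * D"
      using penA(3) by (simp add: mat_transpose_dim(1))
    moreover have "D * (A * D) = D" using penA(2) by (simp add: U_def mat_mult_assoc_dim)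
    ultimately have "G * transpose_mat A = F * (Z * (B * D))"
      by (simp add: G_times KAt mat_one_zero_dim)
    then show ?thesis unfolding H by (simp add: KAt mat_distrib_dim mat_one_zero_dim mat_mult_assoc_dim)
  qed
  have HBt: "H * transpose_mat B = K * R + (1\<^sub>m b - Z)"
  proof -
    have "transpose_mat B - transpose_mat B * (K * R) = transpose_mat B * F"
      unfolding F_def by (simp add: mat_distrib_dim mat_one_zero_dim)
    then have "G * transpose_mat B = F * Z * (B * (D * (transpose_mat D * (transpose_mat B * F))))"
      by (simp add: G_times KBt mat_mult_assoc_dim)
    also have "F * Z = Z * F" by (simp add: FZ ZF)
    also have "Z * F * (B * (D * (transpose_mat D * (transpose_mat B * F)))) = Z * X"
      unfolding X_eq by (simp add: mat_mult_assoc_dim)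
    finally show ?thesis unfolding H by (simp add: mat_distrib_dim KBt ZX1)
  qed
  define C1 where "C1 = D - transpose_mat H * B * D"
  have dC1 [simp]: "dim_row C1 = d" "dim_col C1 = a" by (simp_all add: C1_def)
  have C: "C = append_cols C1 (transpose_mat H)" unfolding C_eq C1_def D_def ..
  have c: "C1 \<in> carrier_mat d a" "transpose_mat H \<in> carrier_mat d b" by (auto intro: carrier_matI)
  show Cc: "C \<in> carrier_mat d (a + b)" unfolding C by (auto intro: carrier_matI)
  have "C * (A @\<^sub>r B) = C1 * A + transpose_mat H * B"
    unfolding C by (rule append_cols_times_append_rows[OF A B c])
  also have "\<dots> = U + transpose_mat H * transpose_mat R"
  proof -
    have "C1 * A = U - transpose_mat H * (B * U)"
      unfolding C1_def U_def by (simp add: mat_mult_assoc_dim mat_distrib_dim)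
    moreover have "transpose_mat H * transpose_mat R = transpose_mat H * B - transpose_mat H * (B * U)"
      unfolding Rt by (simp add: mat_distrib_dim)
    ultimately show ?thesis by (simp only:) (rule eq_matI, auto)
  qed
  also have "transpose_mat H * transpose_mat R = R * K"
    using arg_cong[OF RH, of transpose_mat] RKt by (simp add: mat_transpose_dim(1)[of R H])
  finally have CG: "C * (A @\<^sub>r B) = U + R * K" .
  then show "C * (A @\<^sub>r B) = pinv A * A + R * pinv R" by (simp add: U_def D_def K_def)
  have ACG: "A * (U + R * K) = A"
  proof -
    have "A * (U + R * K) = A * U + A * R * K" by (simp add: mat_distrib_dim mat_mult_assoc_dim)
    then show ?thesis by (simp add: AU AR mat_one_zero_dim)
  qed
  have BCG: "B * (U + R * K) = B"
  proof -
    have "transpose_mat R * (R * K) = transpose_mat R"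
      using arg_cong[OF RKR, of transpose_mat] RKt by (simp add: mat_transpose_dim(1)[of "R * K" R])
    moreover have "transpose_mat R * (R * K) = B * (R * K) - B * (U * R * K)"
      unfolding Rt by (simp add: mat_distrib_dim mat_mult_assoc_dim)
    ultimately have "B * (R * K) = B - B * U"
      by (simp add: UR Rt mat_one_zero_dim)
    then have "B * (U + R * K) = B * U + (B - B * U)" by (simp add: mat_distrib_dim)
    then show ?thesis by (simp only:) (rule eq_matI, auto)
  qed
  have G1: "(A @\<^sub>r B) * (U + R * K) = A @\<^sub>r B"
    by (subst append_rows_times[OF A B]) (auto simp: ACG BCG intro: carrier_matI)
  \<comment> \<open>\<open>U + R * K\<close> fixes the columns of both blocks of \<open>C\<close>, which is the second Penrose equation.\<close>
  have CGD: "(U + R * K) * D = D"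
    using UD KD by (simp add: mat_distrib_dim mat_mult_assoc_dim mat_one_zero_dim)
  have DtCG: "transpose_mat D * (U + R * K) = transpose_mat D"
    using arg_cong[OF CGD, of transpose_mat] Ut RKt
    by (simp add: mat_transpose_dim(1)[of _ D] mat_transpose_dim(2))
  have KCG: "K * (U + R * K) = K"
    using KU KRK by (simp add: mat_distrib_dim mat_mult_assoc_dim mat_one_zero_dim)
  have HCG: "H * (U + R * K) = H"
  proof -
    have "G * (U + R * K) = G"
      by (subst G_times) (simp_all add: KCG mat_distrib_dim(4) DtCG G_def mat_one_zero_dim)
    then show ?thesis unfolding H by (simp add: mat_distrib_dim(1) KCG)
  qed
  have HtCG: "(U + R * K) * transpose_mat H = transpose_mat H"
    using arg_cong[OF HCG, of transpose_mat] Ut RKt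
    by (simp add: mat_transpose_dim(1)[of H] mat_transpose_dim(2))
  have "(U + R * K) * C1 = (U + R * K) * D - (U + R * K) * transpose_mat H * (B * D)"
    unfolding C1_def by (simp add: mat_distrib_dim(4) mat_mult_assoc_dim)
  then have CG1: "(U + R * K) * C1 = C1"
    unfolding CGD HtCG C1_def by (simp add: mat_mult_assoc_dim)
  have CGC: "(U + R * K) * C = C"
    unfolding C by (subst times_append_cols[OF _ c]) (auto simp: CG1 HtCG intro: carrier_matI)
  \<comment> \<open>The off-diagonal blocks of the product are transposes of each other because
      \<open>1 - B * H\<^sup>T = F * Z\<close>.\<close>
  have GC: "(A @\<^sub>r B) * C
      = four_block_mat (A * C1) (A * transpose_mat H) (B * C1) (B * transpose_mat H)"
    unfolding C by (rule append_rows_times_append_cols[OF A B c])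
  have AHt: "A * transpose_mat H = transpose_mat (F * Z * B * D)"
    unfolding HAt[symmetric] by (simp add: mat_transpose_dim(1))
  have BHt: "B * transpose_mat H = K * R + (1\<^sub>m b - Z)"
    using arg_cong[OF HBt, of transpose_mat] KRt Zt by (simp add: mat_transpose_dim(1)[of H] mat_transpose_dim(2,3))
  have s1: "transpose_mat (A * C1) = A * C1"
  proof -
    have "A * C1 = A * D - A * transpose_mat H * (B * D)"
      unfolding C1_def by (simp add: mat_distrib_dim mat_mult_assoc_dim)
    also have "A * transpose_mat H * (B * D) = transpose_mat D * (transpose_mat B * (transpose_mat (F * Z) * (B * D)))"
    proof -
      have "transpose_mat (F * Z * B * D)
          = transpose_mat D * (transpose_mat B * transpose_mat (F * Z))"
        by (simp add: mat_transpose_dim(1))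
      then show ?thesis unfolding AHt by (simp add: mat_mult_assoc_dim)
    qed
    finally have AC1: "A * C1 = A * D - transpose_mat D * (transpose_mat B * (transpose_mat (F * Z) * (B * D)))" .
    define W where "W = F * Z"
    have dW [simp]: "dim_row W = b" "dim_col W = b" by (simp_all add: W_def)
    have Wt: "transpose_mat W = W"
      unfolding W_def by (subst mat_transpose_dim(1)) (simp_all add: Ft Zt FZ ZF)
    show ?thesis unfolding AC1 W_def[symmetric] Wt using penA(3)
      by (simp add: mat_transpose_dim(1,3) Wt mat_mult_assoc_dim)
  qed
  have s2: "B * C1 = F * Z * B * D"
  proof -
    have "B * C1 = B * D - B * transpose_mat H * (B * D)"
      unfolding C1_def by (simp add: mat_distrib_dim mat_mult_assoc_dim)
    also have "\<dots> = (1\<^sub>m b - B * transpose_mat H) * (B * D)"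
      by (simp add: mat_distrib_dim mat_one_zero_dim mat_mult_assoc_dim)
    also have "1\<^sub>m b - B * transpose_mat H = F * Z"
      unfolding BHt FZ by (rule eq_matI) auto
    finally show ?thesis by (simp add: mat_mult_assoc_dim)
  qed
  have GCt: "transpose_mat ((A @\<^sub>r B) * C) = (A @\<^sub>r B) * C"
  proof -
    have bt: "transpose_mat (B * transpose_mat H) = B * transpose_mat H"
      unfolding BHt using KRt Zt by (simp add: mat_transpose_dim(2,3))
    have "transpose_mat ((A @\<^sub>r B) * C) = four_block_mat (transpose_mat (A * C1))
        (transpose_mat (B * C1)) (transpose_mat (A * transpose_mat H)) (transpose_mat (B * transpose_mat H))"
      unfolding GC by (rule transpose_four_block_mat) (auto intro!: carrier_matI)
    also have "\<dots> = (A @\<^sub>r B) * C" unfolding GC s1 bt unfolding s2 AHt by simp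
    finally show ?thesis .
  qed
  have "(A @\<^sub>r B) * C * (A @\<^sub>r B) = A @\<^sub>r B"
    using CG G1 Cc by (simp add: mat_mult_assoc_dim)
  moreover have "C * (A @\<^sub>r B) * C = C" unfolding CG by (rule CGC)
  moreover have "transpose_mat (C * (A @\<^sub>r B)) = C * (A @\<^sub>r B)"
    unfolding CG using Ut RKt by (simp add: mat_transpose_dim(2))
  ultimately show "is_pseudo_inverse (A @\<^sub>r B) C"
    unfolding is_pseudo_inverse_def using GCt Cc by simp
qed

section \<open>Linear least squares\<close>

lemma scalar_prod_add_self:
  fixes u v :: "'a::comm_ring_1 vec"
  assumes "u \<in> carrier_vec n" "v \<in> carrier_vec n"
  shows "(u + v) \<bullet> (u + v) = u \<bullet> u + v \<bullet> v + 2 * (u \<bullet> v)"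
  using assms by (simp add: scalar_prod_add_distrib[of _ n] add_scalar_prod_distrib[of _ n]
      comm_scalar_prod[of v n u])

text \<open>\<open>G C\<close> is the orthogonal projection onto the range of \<open>G\<close>, so the residual at \<open>C *\<^sub>v e\<close> is
  orthogonal to that range.\<close>

lemma least_squares_pythagoras:
  fixes G C :: "real mat"
  assumes GC: "is_pseudo_inverse G C" and G: "G \<in> carrier_mat p d"
    and e: "e \<in> carrier_vec p" and y: "y \<in> carrier_vec d"
  shows "(G *\<^sub>v y - e) \<bullet> (G *\<^sub>v y - e)
    = (G *\<^sub>v (y - C *\<^sub>v e)) \<bullet> (G *\<^sub>v (y - C *\<^sub>v e)) + (G *\<^sub>v (C *\<^sub>v e) - e) \<bullet> (G *\<^sub>v (C *\<^sub>v e) - e)"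
proof -
  let ?x = "C *\<^sub>v e"
  let ?u = "G *\<^sub>v (y - ?x)" and ?w = "G *\<^sub>v ?x - e"
  note gc = GC[unfolded is_pseudo_inverse_def]
  have C: "C \<in> carrier_mat d p" using gc G by auto
  have x: "?x \<in> carrier_vec d" using C e by simp
  have uw: "?u \<in> carrier_vec p" "?w \<in> carrier_vec p" using G C e y by auto
  have sum: "G *\<^sub>v y - e = ?u + ?w"
    using G y x e by (simp add: mult_minus_distrib_mat_vec[of _ p d]) (intro eq_vecI, auto)
  have "transpose_mat (G * C * G) = transpose_mat G * transpose_mat (G * C)"
    using G C by (intro mat_transpose_dim(1)) simp
  then have GtGC: "transpose_mat G * (G * C) = transpose_mat G" using gc by simp
  have "transpose_mat G *\<^sub>v ?w = transpose_mat G *\<^sub>v (G *\<^sub>v ?x) - transpose_mat G *\<^sub>v e"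
    using G x e by (simp add: mult_minus_distrib_mat_vec[of _ d p])
  also have "transpose_mat G *\<^sub>v (G *\<^sub>v ?x) = (transpose_mat G * (G * C)) *\<^sub>v e"
    using G C e by (simp add: assoc_mult_mat_vec[of _ d p _ p] assoc_mult_mat_vec[of _ p d _ p])
  finally have "transpose_mat G *\<^sub>v ?w = 0\<^sub>v d"
    unfolding GtGC using G e by simp
  moreover have "?u \<bullet> ?w = (y - ?x) \<bullet> (transpose_mat G *\<^sub>v ?w)"
  proof -
    have yx: "y - ?x \<in> carrier_vec d" using x y by simp
    have Gw: "transpose_mat G *\<^sub>v ?w \<in> carrier_vec d" using G uw(2) by simp
    show ?thesis
      using transpose_vec_mult_scalar[OF G yx uw(2)] comm_scalar_prod[OF uw]
        comm_scalar_prod[OF yx Gw] by simp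
  qed
  ultimately have "?u \<bullet> ?w = 0" using x y by simp
  then show ?thesis unfolding sum scalar_prod_add_self[OF uw] by simp
qed

text \<open>The fitted vector \<open>G *\<^sub>v y\<close> is the same for all minimizers, by the preceding decomposition; the
  minimizers themselves differ by elements of the kernel of \<open>G\<close>, which is the range of the
  projection \<open>1 - C G\<close>.\<close>

lemma least_squares_solutions:
  fixes G C :: "real mat"
  assumes GC: "is_pseudo_inverse G C" and G: "G \<in> carrier_mat p d"
    and e: "e \<in> carrier_vec p" and y: "y \<in> carrier_vec d"
  shows "(\<forall>z\<in>carrier_vec d. (G *\<^sub>v y - e) \<bullet> (G *\<^sub>v y - e) \<le> (G *\<^sub>v z - e) \<bullet> (G *\<^sub>v z - e))
      \<longleftrightarrow> G *\<^sub>v y = G *\<^sub>v (C *\<^sub>v e)"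
    and "G *\<^sub>v y = G *\<^sub>v (C *\<^sub>v e) \<longleftrightarrow> (\<exists>z\<in>carrier_vec d. y = C *\<^sub>v e + (1\<^sub>m d - C * G) *\<^sub>v z)"
proof -
  note gc = GC[unfolded is_pseudo_inverse_def]
  have C: "C \<in> carrier_mat d p" using gc G by auto
  have x: "C *\<^sub>v e \<in> carrier_vec d" using C e by simp
  note pyth = least_squares_pythagoras[OF GC G e]
  have diff: "G *\<^sub>v (z - C *\<^sub>v e) = G *\<^sub>v z - G *\<^sub>v (C *\<^sub>v e)" if "z \<in> carrier_vec d" for z
    using G x that by (simp add: mult_minus_distrib_mat_vec[of _ p d])
  show "(\<forall>z\<in>carrier_vec d. (G *\<^sub>v y - e) \<bullet> (G *\<^sub>v y - e) \<le> (G *\<^sub>v z - e) \<bullet> (G *\<^sub>v z - e))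
      \<longleftrightarrow> G *\<^sub>v y = G *\<^sub>v (C *\<^sub>v e)" (is "?l \<longleftrightarrow> ?r")
  proof
    assume ?l
    from bspec[OF this x] have "(G *\<^sub>v (y - C *\<^sub>v e)) \<bullet> (G *\<^sub>v (y - C *\<^sub>v e)) \<le> 0"
      unfolding pyth[OF y] by simp
    with sq_norm_ge_0[of "G *\<^sub>v (y - C *\<^sub>v e)"]
    have "(G *\<^sub>v (y - C *\<^sub>v e)) \<bullet> (G *\<^sub>v (y - C *\<^sub>v e)) = 0" by linarith
    then have 0: "G *\<^sub>v y - G *\<^sub>v (C *\<^sub>v e) = 0\<^sub>v p"
      unfolding sq_norm_zero_iff diff[OF y] using G by simp
    show ?r
    proof (intro eq_vecI)
      fix i assume i: "i < dim_vec (G *\<^sub>v (C *\<^sub>v e))"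
      then have "(G *\<^sub>v y - G *\<^sub>v (C *\<^sub>v e)) $ i = 0" unfolding 0 using G by simp
      then show "(G *\<^sub>v y) $ i = (G *\<^sub>v (C *\<^sub>v e)) $ i" using i by simp
    qed simp
  next
    assume r: ?r
    show ?l
    proof
      fix z :: "real vec" assume z: "z \<in> carrier_vec d"
      show "(G *\<^sub>v y - e) \<bullet> (G *\<^sub>v y - e) \<le> (G *\<^sub>v z - e) \<bullet> (G *\<^sub>v z - e)"
        unfolding r pyth[OF z] using sq_norm_ge_0[of "G *\<^sub>v (z - C *\<^sub>v e)"] by linarith
    qed
  qed
  show "G *\<^sub>v y = G *\<^sub>v (C *\<^sub>v e) \<longleftrightarrow> (\<exists>z\<in>carrier_vec d. y = C *\<^sub>v e + (1\<^sub>m d - C * G) *\<^sub>v z)"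
  proof
    assume r: "G *\<^sub>v y = G *\<^sub>v (C *\<^sub>v e)"
    let ?z = "y - C *\<^sub>v e"
    have z: "?z \<in> carrier_vec d" using x y by simp
    have "(1\<^sub>m d - C * G) *\<^sub>v ?z = ?z - C *\<^sub>v (G *\<^sub>v ?z)"
      using z C G by (simp add: minus_mult_distrib_mat_vec[of _ d d] assoc_mult_mat_vec[of _ d p _ d])
    also have "G *\<^sub>v ?z = 0\<^sub>v p" unfolding diff[OF y] r using G C e by simp
    also have "?z - C *\<^sub>v 0\<^sub>v p = ?z" using C z by (intro eq_vecI) (auto simp: scalar_prod_def)
    finally have "y = C *\<^sub>v e + (1\<^sub>m d - C * G) *\<^sub>v ?z" using x y C by (intro eq_vecI) auto
    then show "\<exists>z\<in>carrier_vec d. y = C *\<^sub>v e + (1\<^sub>m d - C * G) *\<^sub>v z" using z by blast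
  next
    assume "\<exists>z\<in>carrier_vec d. y = C *\<^sub>v e + (1\<^sub>m d - C * G) *\<^sub>v z"
    then obtain z where z: "z \<in> carrier_vec d" "y = C *\<^sub>v e + (1\<^sub>m d - C * G) *\<^sub>v z" by blast
    have CG: "C * G \<in> carrier_mat d d" using C G by simp
    have w: "(1\<^sub>m d - C * G) *\<^sub>v z \<in> carrier_vec d"
      by (rule mult_mat_vec_carrier[OF minus_carrier_mat[OF CG] z(1)])
    have "G * (1\<^sub>m d - C * G) = G - G * C * G" using C G by (simp add: mat_algebra)
    also have "\<dots> = 0\<^sub>m p d" using gc G by (simp add: mat_one_zero_dim)
    finally have "G * (1\<^sub>m d - C * G) = 0\<^sub>m p d" .
    with assoc_mult_mat_vec[OF G minus_carrier_mat[OF CG] z(1)]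
    have "G *\<^sub>v ((1\<^sub>m d - C * G) *\<^sub>v z) = 0\<^sub>m p d *\<^sub>v z" by metis
    also have "\<dots> = 0\<^sub>v p" using z(1) by (intro eq_vecI) (auto simp: scalar_prod_def)
    finally have "G *\<^sub>v ((1\<^sub>m d - C * G) *\<^sub>v z) = 0\<^sub>v p" .
    then show "G *\<^sub>v y = G *\<^sub>v (C *\<^sub>v e)"
      unfolding z(2) using G C e x by (simp add: mult_add_distrib_mat_vec[OF G x w])
  qed
qed

section \<open>Vectors and matrices made of blocks\<close>

lemma vec_of_list_append: "vec_of_list (xs @ ys) = vec_of_list xs @\<^sub>v vec_of_list ys"
  by (metis list_of_vec_append list_vec vec_list)

lemma vconcat_simps [simp]:
  "vconcat [] = vNil"
  "vconcat (v # vs) = v @\<^sub>v vconcat vs"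
  by (simp_all add: vconcat_def vec_of_list_append vec_list)

lemma append_vNil [simp]: "v @\<^sub>v vNil = v"
  by (intro eq_vecI) auto

lemma vNil_append [simp]: "vNil @\<^sub>v v = v"
  by (intro eq_vecI) auto

lemma append_vec_assoc: "(u @\<^sub>v v) @\<^sub>v w = u @\<^sub>v (v @\<^sub>v w)"
  by (intro eq_vecI) auto

lemma dim_vconcat [simp]: "dim_vec (vconcat vs) = sum_list (map dim_vec vs)"
  by (induction vs) auto

lemma vconcat_append: "vconcat (vs @ ws) = vconcat vs @\<^sub>v vconcat ws"
  by (induction vs) (auto simp: append_vec_assoc)

lemma vconcat_concat: "vconcat (concat vss) = vconcat (map vconcat vss)"
  by (induction vss) (auto simp: vconcat_append)

lemma vconcat_inject:
  assumes "vconcat vs = vconcat ws" "map dim_vec vs = map dim_vec ws"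
  shows "vs = ws"
  using assms
proof (induction vs arbitrary: ws)
  case (Cons v vs)
  then obtain w ws' where w: "ws = w # ws'" by (cases ws) auto
  have "v \<in> carrier_vec (dim_vec v)" "w \<in> carrier_vec (dim_vec v)"
    using Cons.prems w by (auto intro: carrier_vecI)
  from append_vec_eq[OF this] show ?case using Cons w by auto
qed auto

lemma vconcat_split:
  assumes "y \<in> carrier_vec (sum_list ds)"
  shows "\<exists>ys. y = vconcat ys \<and> map dim_vec ys = ds"
  using assms
proof (induction ds arbitrary: y)
  case Nil
  then show ?case by (intro exI[of _ "[]"]) auto
next
  case (Cons a ds)
  have "vec_last y (sum_list ds) \<in> carrier_vec (sum_list ds)" by simp
  from Cons.IH[OF this] obtain ys where
    "vec_last y (sum_list ds) = vconcat ys" "map dim_vec ys = ds" by blast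
  moreover have "y = vec_first y a @\<^sub>v vec_last y (sum_list ds)"
    using Cons.prems by simp
  ultimately show ?case by (intro exI[of _ "vec_first y a # ys"]) auto
qed

lemma scalar_prod_vconcat_self:
  fixes vs :: "'a::comm_semiring_0 vec list"
  shows "vconcat vs \<bullet> vconcat vs = (\<Sum>v\<leftarrow>vs. v \<bullet> v)"
  by (induction vs) (auto simp: scalar_prod_append[OF carrier_vecI carrier_vecI carrier_vecI carrier_vecI])

lemma append_cols_mult_vec:
  fixes A B :: "'a::comm_ring_1 mat"
  assumes "A \<in> carrier_mat n a" "B \<in> carrier_mat n b" "u \<in> carrier_vec a" "v \<in> carrier_vec b"
  shows "append_cols A B *\<^sub>v (u @\<^sub>v v) = A *\<^sub>v u + B *\<^sub>v v"
proof -
  have "append_cols A B *\<^sub>v (u @\<^sub>v v)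
      = (A *\<^sub>v u + B *\<^sub>v v) @\<^sub>v (0\<^sub>m 0 a *\<^sub>v u + 0\<^sub>m 0 b *\<^sub>v v)"
    unfolding append_cols_def using assms by (subst four_block_mat_mult_vec) auto
  then show ?thesis using assms by (intro eq_vecI) auto
qed

lemma hconcat_dims [simp]:
  "dim_row (hconcat nr As) = nr" "dim_col (hconcat nr As) = sum_list (map dim_col As)"
  by (simp_all add: hconcat_def length_concat comp_def)

lemma cols_hconcat:
  assumes "\<forall>A\<in>set As. dim_row A = nr"
  shows "cols (hconcat nr As) = concat (map cols As)"
  unfolding hconcat_def using assms by (intro cols_mat_of_cols) (auto simp: cols_def)

lemma hconcat_Cons:
  assumes "dim_row A = nr"
  shows "hconcat nr (A # As) = append_cols A (hconcat nr As)"
  using assms unfolding hconcat_def append_cols_def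
  by (intro eq_matI) (auto simp: mat_of_cols_index nth_append)

lemma hconcat_mult_vconcat:
  fixes As :: "'a::comm_ring_1 mat list"
  assumes "list_all2 (\<lambda>A y. A \<in> carrier_mat nr (dim_vec y)) As ys" "i < nr"
  shows "(hconcat nr As *\<^sub>v vconcat ys) $ i = (\<Sum>(A, y)\<leftarrow>zip As ys. (A *\<^sub>v y) $ i)"
  using assms
proof (induction rule: list_all2_induct)
  case Nil
  then show ?case by (simp add: scalar_prod_def)
next
  case (Cons A As y ys)
  have d: "sum_list (map dim_col As) = sum_list (map dim_vec ys)"
    using Cons(2) by (induction rule: list_all2_induct) auto
  have "hconcat nr (A # As) *\<^sub>v vconcat (y # ys) = A *\<^sub>v y + hconcat nr As *\<^sub>v vconcat ys"
    using Cons(1) d by (simp add: hconcat_Cons)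
      (rule append_cols_mult_vec[where a = "dim_vec y" and b = "sum_list (map dim_vec ys)"],
        auto intro!: carrier_matI carrier_vecI)
  then show ?case using Cons by simp
qed

lemma block_diagonal_mult_vec:
  fixes A D :: "'a::comm_ring_1 mat"
  assumes "A \<in> carrier_mat a b" "D \<in> carrier_mat c d" "u \<in> carrier_vec b" "v \<in> carrier_vec d"
  shows "four_block_mat A (0\<^sub>m a d) (0\<^sub>m c b) D *\<^sub>v (u @\<^sub>v v) = (A *\<^sub>v u) @\<^sub>v (D *\<^sub>v v)"
  using assms by (subst four_block_mat_mult_vec[of _ a b _ d _ c]) auto

lemma diag_block_mat_mult_vconcat:
  fixes As :: "'a::comm_ring_1 mat list"
  assumes "list_all2 (\<lambda>A y. dim_col A = dim_vec y) As ys"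
  shows "diag_block_mat As *\<^sub>v vconcat ys = vconcat (map2 (*\<^sub>v) As ys)"
  using assms
proof (induction rule: list_all2_induct)
  case Nil
  then show ?case by (intro eq_vecI) auto
next
  case (Cons A As y ys)
  have d: "dim_col (diag_block_mat As) = dim_vec (vconcat ys)"
    using Cons(2) by (induction rule: list_all2_induct) (auto simp: dim_diag_block_mat)
  let ?D = "diag_block_mat As"
  have "diag_block_mat (A # As) *\<^sub>v vconcat (y # ys) = (A *\<^sub>v y) @\<^sub>v (?D *\<^sub>v vconcat ys)"
    unfolding diag_block_mat.simps Let_def vconcat_simps
    by (rule block_diagonal_mult_vec) (use Cons(1) d in \<open>auto intro!: carrier_matI carrier_vecI\<close>)
  then show ?case using Cons.IH by simp
qed

section \<open>Vectorization and Kronecker products\<close>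

lemma mod_div_less:
  fixes a b k :: nat
  assumes "k < a * b"
  shows "k mod a < a" "k div a < b"
proof -
  have "a > 0" using assms by (cases a) auto
  then show "k mod a < a" by simp
  show "k div a < b" using assms by (simp add: less_mult_imp_div_less mult.commute)
qed

lemma vec_of_mat_index:
  "vec_of_mat A = vec (dim_row A * dim_col A) (\<lambda>k. A $$ (k mod dim_row A, k div dim_row A))"
proof -
  have "vconcat (map (col A) [0..<n]) = vec (dim_row A * n) (\<lambda>k. A $$ (k mod dim_row A, k div dim_row A))"
    if "n \<le> dim_col A" for n
    using that
  proof (induction n)
    case 0
    then show ?case by (intro eq_vecI) auto
  next
    case (Suc n)
    have div: "k div dim_row A = n \<and> k mod dim_row A = k - dim_row A * n"
      if "\<not> k < dim_row A * n" "k < dim_row A + dim_row A * n" for k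
    proof
      show "k div dim_row A = n" by (rule div_nat_eqI) (use that in simp_all)
      then show "k mod dim_row A = k - dim_row A * n"
        using minus_mult_div_eq_mod[of k "dim_row A"] by simp
    qed
    show ?case
      using Suc by (intro eq_vecI) (auto simp: vconcat_append div)
  qed
  from this[of "dim_col A"] show ?thesis by (simp add: vec_of_mat_def cols_def)
qed

lemma dim_vec_of_mat [simp]: "dim_vec (vec_of_mat A) = dim_row A * dim_col A"
  by (simp add: vec_of_mat_index)

lemma map_vec_of_mat: "map_vec f (vec_of_mat A) = vec_of_mat (map_mat f A)"
proof (intro eq_vecI)
  fix k assume "k < dim_vec (vec_of_mat (map_mat f A))"
  then have k: "k < dim_row A * dim_col A" by simp
  from mod_div_less[OF this] show "map_vec f (vec_of_mat A) $ k = vec_of_mat (map_mat f A) $ k"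
    using k by (simp add: vec_of_mat_index)
qed simp

lemma vec_of_mat_hconcat:
  assumes "\<forall>A\<in>set As. dim_row A = nr"
  shows "vec_of_mat (hconcat nr As) = vconcat (map vec_of_mat As)"
  unfolding vec_of_mat_def using assms by (simp add: cols_hconcat vconcat_concat comp_def)

lemma append_cols_hconcat:
  "dim_row A = dim_row B \<Longrightarrow> append_cols A B = hconcat (dim_row A) [A, B]"
proof -
  assume a: "dim_row A = dim_row B"
  have "hconcat (dim_row A) [B] = B" using a by (simp add: hconcat_def)
  then show ?thesis by (simp add: hconcat_Cons)
qed

lemma vec_of_mat_append_cols:
  "dim_row A = dim_row B \<Longrightarrow> vec_of_mat (append_cols A B) = vec_of_mat A @\<^sub>v vec_of_mat B"
  by (simp add: append_cols_hconcat vec_of_mat_hconcat)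

lemma vec_of_mat_inject:
  assumes "vec_of_mat A = vec_of_mat B" "dim_row A = dim_row B" "dim_col A = dim_col B"
  shows "A = B"
proof -
  have "map dim_vec (cols A) = map dim_vec (cols B)"
    using assms(2,3) by (simp add: cols_def comp_def)
  with assms(1) have "cols A = cols B" unfolding vec_of_mat_def by (rule vconcat_inject)
  then show ?thesis using mat_of_cols_cols assms(2) by metis
qed

lemma sum_div_mod:
  fixes f :: "nat \<Rightarrow> nat \<Rightarrow> 'a::comm_monoid_add"
  shows "(\<Sum>k<a * b. f (k mod a) (k div a)) = (\<Sum>i<a. \<Sum>j<b. f i j)"
proof -
  have "(\<Sum>k<b * a. f (k mod a) (k div a)) = (\<Sum>j<b. \<Sum>k = j * a..<j * a + a. f (k mod a) (k div a))"
    by (simp add: sum.nat_group)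
  also have "\<dots> = (\<Sum>j<b. \<Sum>i<a. f i j)"
  proof (rule sum.cong[OF refl])
    fix j
    have "(\<Sum>k = j * a..<j * a + a. f (k mod a) (k div a))
        = (\<Sum>i = 0..<a. f ((i + j * a) mod a) ((i + j * a) div a))"
      using sum.shift_bounds_nat_ivl[of "\<lambda>k. f (k mod a) (k div a)" 0 "j * a" a]
      by (simp add: add.commute)
    also have "\<dots> = (\<Sum>i<a. f i j)"
      by (rule sum.cong) auto
    finally show "(\<Sum>k = j * a..<j * a + a. f (k mod a) (k div a)) = (\<Sum>i<a. f i j)" .
  qed
  also have "\<dots> = (\<Sum>i<a. \<Sum>j<b. f i j)" by (rule sum.swap)
  finally show ?thesis by (simp add: mult.commute)
qed

text \<open>Entry \<open>k\<close> of either side belongs to row \<open>k mod m\<close> and column \<open>k div m\<close> of the triple product;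
  \<open>sum_div_mod\<close> turns the sum over the columns of the Kronecker product into the double sum of
  that entry.\<close>

lemma kronecker_mult_vec:
  fixes A B X :: "'a::comm_ring_1 mat"
  assumes A: "A \<in> carrier_mat m n" and X: "X \<in> carrier_mat n s" and B: "B \<in> carrier_mat s t"
  shows "kronecker (transpose_mat B) A *\<^sub>v vec_of_mat X = vec_of_mat (A * X * B)"
proof (intro eq_vecI)
  show "dim_vec (kronecker (transpose_mat B) A *\<^sub>v vec_of_mat X) = dim_vec (vec_of_mat (A * X * B))"
    using assms by (simp add: kronecker_def mult.commute)
  fix k assume "k < dim_vec (vec_of_mat (A * X * B))"
  then have k: "k < m * t" using assms by simp
  define i j where "i = k mod m" and "j = k div m"
  have ij: "i < m" "j < t" using k unfolding i_def j_def
    by (rule mod_div_less)+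
  have "(kronecker (transpose_mat B) A *\<^sub>v vec_of_mat X) $ k
      = (\<Sum>l<n * s. B $$ (l div n, j) * A $$ (i, l mod n) * X $$ (l mod n, l div n))"
    using assms k ij by (auto simp: mod_div_less kronecker_def vec_of_mat_index scalar_prod_def i_def j_def
        mult.commute atLeast0LessThan intro!: sum.cong)
  also have "\<dots> = (\<Sum>p<n. \<Sum>q<s. B $$ (q, j) * A $$ (i, p) * X $$ (p, q))"
    by (rule sum_div_mod)
  also have "\<dots> = (\<Sum>q<s. (\<Sum>p<n. A $$ (i, p) * X $$ (p, q)) * B $$ (q, j))"
    by (subst sum.swap) (simp add: sum_distrib_left sum_distrib_right mult_ac)
  also have "\<dots> = (\<Sum>q<s. (A * X) $$ (i, q) * B $$ (q, j))"
    using A X ij by (intro sum.cong refl) (simp add: mat_mult_index del: index_mult_mat(1))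
  also have "\<dots> = (A * X * B) $$ (i, j)"
    using assms ij by (subst mat_mult_index[of _ "A * X"]) auto
  also have "\<dots> = vec_of_mat (A * X * B) $ k"
    using assms k by (simp add: vec_of_mat_index i_def j_def)
  finally show "(kronecker (transpose_mat B) A *\<^sub>v vec_of_mat X) $ k = vec_of_mat (A * X * B) $ k" .
qed

lemma sq_norm_vec_of_mat:
  fixes A :: "real mat"
  shows "vec_of_mat A \<bullet> vec_of_mat A = (\<Sum>i<dim_row A. \<Sum>j<dim_col A. (A $$ (i, j))\<^sup>2)"
  unfolding vec_of_mat_index scalar_prod_def
  by (simp add: atLeast0LessThan power2_eq_square sum_div_mod[symmetric])

section \<open>Complex and real representations of reduced biquaternion matrices\<close>

lemma cpart_simps [simp]:
  "cpart1 0 = 0" "cpart2 0 = 0"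
  "cpart1 (x + y) = cpart1 x + cpart1 y" "cpart2 (x + y) = cpart2 x + cpart2 y"
  "cpart1 (x - y) = cpart1 x - cpart1 y" "cpart2 (x - y) = cpart2 x - cpart2 y"
  "cpart1 (x * y) = cpart1 x * cpart1 y + cpart2 x * cpart2 y"
  "cpart2 (x * y) = cpart1 x * cpart2 y + cpart2 x * cpart1 y"
  "cpart1 rb_j = 0" "cpart2 rb_j = 1"
  by (simp_all add: cpart1_def cpart2_def complex_eq_iff zero_rbq_def plus_rbq_def minus_rbq_def
      times_rbq_def rb_j_def algebra_simps)

lemma cpart_sum:
  "cpart1 (\<Sum>i\<in>I. f i) = (\<Sum>i\<in>I. cpart1 (f i))" "cpart2 (\<Sum>i\<in>I. f i) = (\<Sum>i\<in>I. cpart2 (f i))"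
  by (induction I rule: infinite_finite_induct) auto

lemma cmat_dims [simp]:
  "dim_row (cmat1 Z) = dim_row Z" "dim_col (cmat1 Z) = dim_col Z"
  "dim_row (cmat2 Z) = dim_row Z" "dim_col (cmat2 Z) = dim_col Z"
  by (simp_all add: cmat1_def cmat2_def)

lemma cmat_times:
  assumes "dim_col X = dim_row Y"
  shows "cmat1 (X * Y) = cmat1 X * cmat1 Y + cmat2 X * cmat2 Y"
    and "cmat2 (X * Y) = cmat1 X * cmat2 Y + cmat2 X * cmat1 Y"
  using assms by (auto simp: cmat1_def cmat2_def scalar_prod_def cpart_sum sum.distrib intro!: eq_matI)

lemma cmat_smult_j:
  "cmat1 (rb_j \<cdot>\<^sub>m X) = cmat2 X" "cmat2 (rb_j \<cdot>\<^sub>m X) = cmat1 X"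
  by (auto simp: cmat1_def cmat2_def intro!: eq_matI)

lemma Psi_dims [simp]: "dim_row (Psi Z) = dim_row Z" "dim_col (Psi Z) = 2 * dim_col Z"
  by (simp_all add: Psi_def)

lemma h_rep_carrier: "X \<in> carrier_mat p q \<Longrightarrow> h_rep X \<in> carrier_mat (2 * p) (2 * q)"
  unfolding h_rep_def by (auto intro: carrier_matI)

lemma append_cols_add:
  "dim_row A = dim_row C \<Longrightarrow> dim_col A = dim_col C \<Longrightarrow> dim_row B = dim_row D \<Longrightarrow> dim_col B = dim_col D
    \<Longrightarrow> dim_row A = dim_row B \<Longrightarrow>
    append_cols A B + append_cols C D = append_cols (A + C) (B + D)"
  for A :: "'a::monoid_add mat"
  unfolding append_cols_def by (intro eq_matI) auto

lemma append_cols_times_four_block: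
  fixes A B C D F G :: "'a::comm_ring_1 mat"
  assumes "A \<in> carrier_mat n a" "B \<in> carrier_mat n b" "C \<in> carrier_mat a c" "D \<in> carrier_mat a d"
    "F \<in> carrier_mat b c" "G \<in> carrier_mat b d"
  shows "append_cols A B * four_block_mat C D F G = append_cols (A * C + B * F) (A * D + B * G)"
proof -
  have "append_cols A B * four_block_mat C D F G = four_block_mat (A * C + B * F) (A * D + B * G)
      (0\<^sub>m 0 a * C + 0\<^sub>m 0 b * F) (0\<^sub>m 0 a * D + 0\<^sub>m 0 b * G)"
    unfolding append_cols_def using assms by (subst mult_four_block_mat[of _ _ a _ b]) auto
  then show ?thesis using assms unfolding append_cols_def by (simp add: mat_one_zero_dim)
qed

lemma Psi_times_h_rep:
  assumes X: "X \<in> carrier_mat n s" and B: "B \<in> carrier_mat s t"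
  shows "Psi (X * B) = Psi X * h_rep B"
proof -
  have "Psi X * h_rep B = append_cols (cmat1 X * cmat1 B + cmat2 X * cmat2 B)
      (cmat1 X * cmat2 B + cmat2 X * cmat1 B)"
    unfolding Psi_def h_rep_def using assms
    by (intro append_cols_times_four_block[of _ n s _ s _ t _ t]) (auto intro!: carrier_matI)
  then show ?thesis using assms by (simp add: Psi_def cmat_times)
qed

text \<open>The \<open>rb_j\<close>-component of \<open>A\<close> interchanges the two complex parts of \<open>Y\<close>, which is what
  multiplication of \<open>Y\<close> by \<open>rb_j\<close> does.\<close>

lemma Psi_times_left:
  assumes A: "A \<in> carrier_mat m n" and Y: "Y \<in> carrier_mat n s"
  shows "Psi (A * Y) = cmat1 A * Psi Y + cmat2 A * Psi (rb_j \<cdot>\<^sub>m Y)"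
proof -
  have 1: "cmat1 A * Psi Y = append_cols (cmat1 A * cmat1 Y) (cmat1 A * cmat2 Y)"
    unfolding Psi_def using assms
    by (intro times_append_cols[of _ m n _ s _ s]) (auto intro!: carrier_matI)
  have 2: "cmat2 A * Psi (rb_j \<cdot>\<^sub>m Y) = append_cols (cmat2 A * cmat2 Y) (cmat2 A * cmat1 Y)"
    unfolding Psi_def cmat_smult_j using assms
    by (intro times_append_cols[of _ m n _ s _ s]) (auto intro!: carrier_matI)
  show ?thesis unfolding 1 2 using assms by (simp add: Psi_def append_cols_add cmat_times)
qed

lemma kronecker_dims [simp]:
  "dim_row (kronecker A B) = dim_row A * dim_row B" "dim_col (kronecker A B) = dim_col A * dim_col B"
  by (simp_all add: kronecker_def)

lemma vec_of_mat_add: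
  "dim_row A = dim_row B \<Longrightarrow> dim_col A = dim_col B \<Longrightarrow>
   vec_of_mat (A + B) = vec_of_mat A + vec_of_mat B"
  for A :: "'a::plus mat"
  by (intro eq_vecI) (auto simp: vec_of_mat_index mod_div_less)

text \<open>Since \<open>Psi (X B) = Psi X * h_rep B\<close>, and multiplying \<open>X B\<close> by \<open>rb_j\<close> amounts to replacing \<open>B\<close> by
  \<open>rb_j B\<close>, the representation of the product is \<open>A1 Psi(X) h(B) + A2 Psi(X) h(jB)\<close>. Both terms
  are triple products of complex matrices, to which the Kronecker identity applies.\<close>

lemma vec_Psi_product:
  assumes A: "A \<in> carrier_mat m n" and X: "X \<in> carrier_mat n s" and B: "B \<in> carrier_mat s t"
  shows "vec_of_mat (Psi (A * X * B)) =
    (kronecker (transpose_mat (h_rep B)) (cmat1 A)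
       + kronecker (transpose_mat (h_rep (rb_j \<cdot>\<^sub>m B))) (cmat2 A)) *\<^sub>v vec_of_mat (Psi X)"
proof -
  have jB: "rb_j \<cdot>\<^sub>m B \<in> carrier_mat s t" using B by simp
  have c: "cmat1 A \<in> carrier_mat m n" "cmat2 A \<in> carrier_mat m n" "Psi X \<in> carrier_mat n (2 * s)"
    using A X by (auto intro!: carrier_matI)
  note hB = h_rep_carrier[OF B] and hjB = h_rep_carrier[OF jB]
  have "A * X * B = A * (X * B)" using assms by (rule assoc_mult_mat)
  moreover have "rb_j \<cdot>\<^sub>m (X * B) = X * (rb_j \<cdot>\<^sub>m B)" using X B by (simp add: mult_smult_distrib)
  ultimately have "Psi (A * X * B)
      = cmat1 A * (Psi X * h_rep B) + cmat2 A * (Psi X * h_rep (rb_j \<cdot>\<^sub>m B))"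
    using A X B jB by (simp add: Psi_times_left[of A m n _ t] Psi_times_h_rep[OF X B] Psi_times_h_rep[OF X jB])
  also have "\<dots> = cmat1 A * Psi X * h_rep B + cmat2 A * Psi X * h_rep (rb_j \<cdot>\<^sub>m B)"
    using c hB hjB by simp
  finally have "vec_of_mat (Psi (A * X * B)) = vec_of_mat (cmat1 A * Psi X * h_rep B)
      + vec_of_mat (cmat2 A * Psi X * h_rep (rb_j \<cdot>\<^sub>m B))"
    using c hB hjB A by (simp add: vec_of_mat_add)
  also have "\<dots> = kronecker (transpose_mat (h_rep B)) (cmat1 A) *\<^sub>v vec_of_mat (Psi X)
      + kronecker (transpose_mat (h_rep (rb_j \<cdot>\<^sub>m B))) (cmat2 A) *\<^sub>v vec_of_mat (Psi X)"
    by (simp only: kronecker_mult_vec[OF c(1,3) hB] kronecker_mult_vec[OF c(2,3) hjB])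
  also have "\<dots> = (kronecker (transpose_mat (h_rep B)) (cmat1 A)
       + kronecker (transpose_mat (h_rep (rb_j \<cdot>\<^sub>m B))) (cmat2 A)) *\<^sub>v vec_of_mat (Psi X)"
    using A X hB hjB
    by (intro add_mult_distrib_mat_vec[symmetric, of _ "2 * t * m" "2 * s * n"])
       (auto intro!: carrier_matI carrier_vecI)
  finally show ?thesis .
qed

lemma vec_real_rep:
  "vec_of_mat (real_rep Z) = (vec_of_mat (map_mat Re (cmat1 Z)) @\<^sub>v vec_of_mat (map_mat Im (cmat1 Z)))
     @\<^sub>v (vec_of_mat (map_mat Re (cmat2 Z)) @\<^sub>v vec_of_mat (map_mat Im (cmat2 Z)))"
  unfolding real_rep_def by (subst vec_of_mat_hconcat) (auto simp: append_vec_assoc)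

lemma real_rep_dims [simp]: "dim_row (real_rep Z) = dim_row Z" "dim_col (real_rep Z) = 4 * dim_col Z"
  by (simp_all add: real_rep_def)

lemma map_vec_append: "map_vec f (u @\<^sub>v v) = map_vec f u @\<^sub>v map_vec f v"
  by (intro eq_vecI) auto

text \<open>\<open>W_mat\<close> reassembles the complex parts from their real and imaginary parts.\<close>

lemma W_mat_mult_real_rep:
  assumes X: "X \<in> carrier_mat n s"
  shows "W_mat (n * s) *\<^sub>v map_vec of_real (vec_of_mat (real_rep X)) = vec_of_mat (Psi X)"
proof -
  define N where "N = n * s"
  define U where "U = append_cols (1\<^sub>m N) (\<i> \<cdot>\<^sub>m 1\<^sub>m N)"
  have U: "U \<in> carrier_mat N (2 * N)" unfolding U_def by (auto intro!: carrier_matI)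
  have UC: "U *\<^sub>v (map_vec of_real (vec_of_mat (map_mat Re C))
      @\<^sub>v map_vec of_real (vec_of_mat (map_mat Im C))) = vec_of_mat C"
    if C: "C \<in> carrier_mat n s" for C
  proof -
    let ?u = "map_vec of_real (vec_of_mat (map_mat Re C)) :: complex vec"
    let ?v = "map_vec of_real (vec_of_mat (map_mat Im C)) :: complex vec"
    have uv: "?u \<in> carrier_vec N" "?v \<in> carrier_vec N" using C by (auto simp: N_def intro!: carrier_vecI)
    have "U *\<^sub>v (?u @\<^sub>v ?v) = 1\<^sub>m N *\<^sub>v ?u + (\<i> \<cdot>\<^sub>m 1\<^sub>m N) *\<^sub>v ?v"
      unfolding U_def by (rule append_cols_mult_vec[OF _ _ uv]) auto
    also have "(\<i> \<cdot>\<^sub>m 1\<^sub>m N) *\<^sub>v ?v = \<i> \<cdot>\<^sub>v (1\<^sub>m N *\<^sub>v ?v)"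
    proof (intro eq_vecI)
      fix i assume "i < dim_vec (\<i> \<cdot>\<^sub>v (1\<^sub>m N *\<^sub>v ?v))"
      then have i: "i < N" by simp
      moreover have "dim_row C * dim_col C = N" using C by (simp add: N_def)
      ultimately show "((\<i> \<cdot>\<^sub>m 1\<^sub>m N) *\<^sub>v ?v) $ i = (\<i> \<cdot>\<^sub>v (1\<^sub>m N *\<^sub>v ?v)) $ i"
        by (simp add: scalar_prod_def sum_distrib_left mult.assoc)
    qed simp
    also have "1\<^sub>m N *\<^sub>v ?u + \<i> \<cdot>\<^sub>v (1\<^sub>m N *\<^sub>v ?v) = ?u + \<i> \<cdot>\<^sub>v ?v" using uv by simp
    also have "\<dots> = vec_of_mat C"
      using C by (intro eq_vecI) (auto simp: vec_of_mat_index mod_div_less complex_eq_iff)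
    finally show ?thesis .
  qed
  let ?w = "\<lambda>C. map_vec of_real (vec_of_mat (map_mat Re C))
      @\<^sub>v map_vec of_real (vec_of_mat (map_mat Im C)) :: complex vec"
  have c: "cmat1 X \<in> carrier_mat n s" "cmat2 X \<in> carrier_mat n s" using X by (auto intro!: carrier_matI)
  then have w: "?w (cmat1 X) \<in> carrier_vec (2 * N)" "?w (cmat2 X) \<in> carrier_vec (2 * N)"
    using X by (auto simp: N_def intro!: carrier_vecI)
  have "W_mat N *\<^sub>v (?w (cmat1 X) @\<^sub>v ?w (cmat2 X))
      = (U *\<^sub>v ?w (cmat1 X)) @\<^sub>v (U *\<^sub>v ?w (cmat2 X))"
    unfolding W_mat_def U_def[symmetric] by (rule block_diagonal_mult_vec[OF U U w])
  then show ?thesis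
    unfolding UC[OF c(1)] UC[OF c(2)] unfolding vec_real_rep map_vec_append N_def Psi_def
    by (simp add: vec_of_mat_append_cols)
qed

text \<open>The real coordinates determine \<open>Psi\<close>, hence both complex parts of every entry.\<close>

lemma real_rep_inject:
  assumes "vec_of_mat (real_rep X) = vec_of_mat (real_rep Y)" "X \<in> carrier_mat p q" "Y \<in> carrier_mat p q"
  shows "X = Y"
proof -
  have "vec_of_mat (Psi X) = vec_of_mat (Psi Y)"
    using W_mat_mult_real_rep[OF assms(2)] W_mat_mult_real_rep[OF assms(3)] assms(1) by simp
  then have "vec_of_mat (cmat1 X) = vec_of_mat (cmat1 Y) \<and> vec_of_mat (cmat2 X) = vec_of_mat (cmat2 Y)"
    unfolding Psi_def using assms(2,3)
    by (simp add: vec_of_mat_append_cols append_vec_eq[of _ "p * q"] carrier_vecI)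
  then have "cmat1 X = cmat1 Y" "cmat2 X = cmat2 Y"
    using assms(2,3) by (auto intro!: vec_of_mat_inject)
  then have "cpart1 (X $$ (i, j)) = cpart1 (Y $$ (i, j)) \<and> cpart2 (X $$ (i, j)) = cpart2 (Y $$ (i, j))"
    if "i < p" "j < q" for i j
    using that assms(2,3) unfolding cmat1_def cmat2_def by (metis carrier_matD index_map_mat(1))
  then show ?thesis
    using assms(2,3) by (intro eq_matI) (auto simp: rbq_eq_iff cpart1_def cpart2_def)
qed

lemma rb_norm_sq: "(rb_norm x)\<^sup>2 = (Re (cpart1 x))\<^sup>2 + (Im (cpart1 x))\<^sup>2 + (Re (cpart2 x))\<^sup>2 + (Im (cpart2 x))\<^sup>2"
  by (simp add: rb_norm_def cpart1_def cpart2_def)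

lemma fro_norm_sq: "(fro_norm Z)\<^sup>2 = (\<Sum>i<dim_row Z. \<Sum>j<dim_col Z. (rb_norm (Z $$ (i, j)))\<^sup>2)"
  unfolding fro_norm_def by (intro real_sqrt_pow2 sum_nonneg) auto

lemma scalar_prod_append_self:
  "(u @\<^sub>v v) \<bullet> (u @\<^sub>v v) = u \<bullet> u + v \<bullet> v" for u :: "'a::comm_semiring_0 vec"
  by (rule scalar_prod_append) (auto intro: carrier_vecI)

lemma fro_norm_real_rep: "(fro_norm Z)\<^sup>2 = vec_of_mat (real_rep Z) \<bullet> vec_of_mat (real_rep Z)"
  unfolding vec_real_rep scalar_prod_append_self sq_norm_vec_of_mat fro_norm_sq
  by (simp add: rb_norm_sq cmat1_def cmat2_def sum.distrib)

lemma map_mat_append_cols: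
  "dim_row A = dim_row B \<Longrightarrow> map_mat f (append_cols A B) = append_cols (map_mat f A) (map_mat f B)"
  unfolding append_cols_def by (intro eq_matI) auto

text \<open>Each entry contributes the squares of its four real components, which reappear as the real and
  imaginary parts of the two complex parts.\<close>

lemma fro_norm_Psi:
  "(fro_norm Z)\<^sup>2 = vec_of_mat (map_mat Re (Psi Z)) \<bullet> vec_of_mat (map_mat Re (Psi Z))
     + vec_of_mat (map_mat Im (Psi Z)) \<bullet> vec_of_mat (map_mat Im (Psi Z))"
  unfolding fro_norm_real_rep vec_real_rep
  by (simp add: Psi_def map_mat_append_cols vec_of_mat_append_cols scalar_prod_append_self)

section \<open>The residual in real coordinates\<close>

text \<open>The coordinate vectors of the structure form the column space of its basis matrix; in this form
  they can be parametrized by real vectors.\<close>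

lemma basis_matrix_range:
  assumes "basis_matrix p q L M"
  shows "(\<lambda>X. vec_of_mat (real_rep X)) ` L = (\<lambda>y. M *\<^sub>v y) ` carrier_vec (dim_col M)"
proof -
  interpret vec_space "TYPE(real)" "4 * p * q" .
  note b = assms[unfolded basis_matrix_def]
  have M: "M \<in> carrier_mat (4 * p * q) (dim_col M)" using b by (auto intro: carrier_matI)
  have "(\<lambda>X. vec_of_mat (real_rep X)) ` L = col_space M" using b unfolding col_space_def by simp
  also have "\<dots> = (\<lambda>y. M *\<^sub>v y) ` carrier_vec (dim_col M)"
  proof -
    have "M *\<^sub>v y \<in> carrier_vec (dim_row M)" for y by (simp add: carrier_vecI)
    then show ?thesis unfolding col_space_eq[OF M] by blast
  qed
  finally show ?thesis .
qed

text \<open>Because \<open>y\<close> is real, taking real or imaginary parts commutes with the product. This is how the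
  complex system turns into a real one with twice as many equations.\<close>

lemma Re_Im_mult_mat_vec:
  fixes S :: "complex mat" and y :: "real vec"
  assumes "dim_col S = dim_vec y" "k < dim_row S"
  shows "Re ((S *\<^sub>v map_vec of_real y) $ k) = (map_mat Re S *\<^sub>v y) $ k"
    and "Im ((S *\<^sub>v map_vec of_real y) $ k) = (map_mat Im S *\<^sub>v y) $ k"
  using assms by (auto simp: scalar_prod_def)

lemma hconcat_mult_blocks:
  fixes As :: "nat \<Rightarrow> 'a::comm_ring_1 mat"
  assumes "\<And>l. l < r \<Longrightarrow> As l \<in> carrier_mat nr (dim_vec (ys l))" "i < nr"
  shows "(hconcat nr (map As [0..<r]) *\<^sub>v vconcat (map ys [0..<r])) $ i = (\<Sum>l<r. (As l *\<^sub>v ys l) $ i)"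
  using assms by (subst hconcat_mult_vconcat)
    (auto simp: list_all2_conv_all_nth zip_map_map zip_same_conv_map comp_def
      interv_sum_list_conv_sum_set_nat atLeast0LessThan)

lemma diag_block_mat_mult_blocks:
  fixes As :: "nat \<Rightarrow> 'a::comm_ring_1 mat"
  assumes "\<And>l. l < r \<Longrightarrow> dim_col (As l) = dim_vec (ys l)"
  shows "diag_block_mat (map As [0..<r]) *\<^sub>v vconcat (map ys [0..<r])
    = vconcat (map (\<lambda>l. As l *\<^sub>v ys l) [0..<r])"
  using assms by (subst diag_block_mat_mult_vconcat)
    (auto simp: list_all2_conv_all_nth zip_map_map zip_same_conv_map comp_def)

text \<open>Entrywise linearity of \<open>Psi\<close>. An index below \<open>m * t\<close> addresses the first complex part of an entry,
  the remaining ones address the second part.\<close>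

lemma vec_Psi_residual:
  assumes A: "\<And>l. l < r \<Longrightarrow> A l \<in> carrier_mat m (n l)" and B: "\<And>l. l < r \<Longrightarrow> B l \<in> carrier_mat (s l) t"
    and E: "E \<in> carrier_mat m t"
    and X: "\<And>l. l < r \<Longrightarrow> Xs ! l \<in> carrier_mat (n l) (s l)" and k: "k < 2 * m * t"
  shows "vec_of_mat (Psi (residual r m t A B E Xs)) $ k
    = (\<Sum>l<r. vec_of_mat (Psi (A l * Xs ! l * B l)) $ k) - vec_of_mat (Psi E) $ k"
proof -
  define i j where "i = k mod m" and "j = k div m"
  have ij: "i < m" "j < 2 * t" using mod_div_less[of k m "2 * t"] k by (simp_all add: i_def j_def mult_ac)
  have kk: "k < m * (t + t)" using k by (simp add: algebra_simps)
  have idx: "vec_of_mat (Psi Z) $ k = (if j < t then cpart1 (Z $$ (i, j)) else cpart2 (Z $$ (i, j - t)))"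
    if "Z \<in> carrier_mat m t" for Z
    using that ij kk unfolding vec_of_mat_index Psi_def append_cols_def
    by (auto simp: i_def[symmetric] j_def[symmetric] cmat1_def cmat2_def)
  have c: "A l * Xs ! l * B l \<in> carrier_mat m t" if "l < r" for l
    using A[OF that] B[OF that] X[OF that] by simp
  have "residual r m t A B E Xs \<in> carrier_mat m t"
    unfolding residual_def by (rule minus_carrier_mat[OF E])
  from idx[OF this] show ?thesis
    using ij E by (auto simp: idx[OF c] idx[OF E] residual_def cpart_sum simp del: index_mult_mat)
qed

lemma vec_to_blocks:
  fixes y :: "'a vec"
  assumes "y \<in> carrier_vec (\<Sum>l<r. k l)"
  obtains ys where "\<And>l. l < r \<Longrightarrow> ys l \<in> carrier_vec (k l)" "y = vconcat (map ys [0..<r])"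
proof -
  have "y \<in> carrier_vec (sum_list (map k [0..<r]))"
    using assms by (simp add: interv_sum_list_conv_sum_set_nat atLeast0LessThan)
  then obtain zs where zs: "y = vconcat zs" "map dim_vec zs = map k [0..<r]"
    using vconcat_split by blast
  have len: "length zs = r" using arg_cong[OF zs(2), of length] by simp
  show thesis
  proof (rule that[of "\<lambda>l. zs ! l"])
    show "zs ! l \<in> carrier_vec (k l)" if "l < r" for l
      using arg_cong[OF zs(2), of "\<lambda>xs. xs ! l"] that len by (auto intro!: carrier_vecI)
    show "y = vconcat (map (\<lambda>l. zs ! l) [0..<r])"
      unfolding zs(1) len[symmetric] map_nth ..
  qed
qed

lemma vconcat_blocks_inject:
  assumes "vconcat (map us [0..<r]) = vconcat (map vs [0..<r])"
    and "\<And>l. l < r \<Longrightarrow> dim_vec (us l) = dim_vec (vs l)" and "l < r"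
  shows "us l = vs l"
proof -
  have "map us [0..<r] = map vs [0..<r]"
    by (rule vconcat_inject[OF assms(1)]) (simp add: assms(2))
  from arg_cong[OF this, of "\<lambda>xs. xs ! l"] show ?thesis using assms(3) by simp
qed

lemma vconcat_blocks_carrier:
  assumes "\<And>l. l < r \<Longrightarrow> ys l \<in> carrier_vec (k l)"
  shows "vconcat (map ys [0..<r]) \<in> carrier_vec (\<Sum>l<r. k l)"
  using assms
  by (intro carrier_vecI) (auto simp: interv_sum_list_conv_sum_set_nat atLeast0LessThan comp_def intro!: sum.cong)

lemma coord_vec_blocks:
  "length Xs = r \<Longrightarrow> coord_vec Xs = vconcat (map (\<lambda>l. vec_of_mat (real_rep (Xs ! l))) [0..<r])"
  unfolding coord_vec_def by (rule arg_cong[of _ _ vconcat]) (auto intro: nth_equalityI)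

text \<open>Makes uniqueness of a coordinate vector into uniqueness of a tuple.\<close>

lemma coord_vec_inject:
  assumes "coord_vec Xs = coord_vec Ys" "length Xs = r" "length Ys = r"
    and X: "\<And>l. l < r \<Longrightarrow> Xs ! l \<in> carrier_mat (n l) (s l)"
    and Y: "\<And>l. l < r \<Longrightarrow> Ys ! l \<in> carrier_mat (n l) (s l)"
  shows "Xs = Ys"
proof (rule nth_equalityI)
  show "length Xs = length Ys" using assms(2,3) by simp
  fix l assume "l < length Xs"
  then have l: "l < r" using assms(2) by simp
  have "vec_of_mat (real_rep (Xs ! l)) = vec_of_mat (real_rep (Ys ! l))"
  proof (rule vconcat_blocks_inject[OF _ _ l])
    show "vconcat (map (\<lambda>l. vec_of_mat (real_rep (Xs ! l))) [0..<r])
        = vconcat (map (\<lambda>l. vec_of_mat (real_rep (Ys ! l))) [0..<r])"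
      using assms(1) unfolding coord_vec_blocks[OF assms(2)] coord_vec_blocks[OF assms(3)] .
    show "dim_vec (vec_of_mat (real_rep (Xs ! k))) = dim_vec (vec_of_mat (real_rep (Ys ! k)))"
      if "k < r" for k using X[OF that] Y[OF that] by simp
  qed
  then show "Xs ! l = Ys ! l" using X[OF l] Y[OF l] by (rule real_rep_inject)
qed

lemma tuple_fro_norm_coord: "tuple_fro_norm Xs = sqrt (coord_vec Xs \<bullet> coord_vec Xs)"
  unfolding tuple_fro_norm_def coord_vec_def scalar_prod_vconcat_self fro_norm_real_rep
  by (simp add: comp_def)

lemma append_rows_mult_vec_minus:
  fixes A B :: "'a::comm_ring_1 mat"
  assumes "A \<in> carrier_mat a d" "B \<in> carrier_mat b d" "y \<in> carrier_vec d" "u \<in> carrier_vec a" "v \<in> carrier_vec b"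
  shows "(A @\<^sub>r B) *\<^sub>v y - (u @\<^sub>v v) = (A *\<^sub>v y - u) @\<^sub>v (B *\<^sub>v y - v)"
  unfolding mat_mult_append[OF assms(1-3)] using assms by (intro eq_vecI) auto

lemma W_mat_carrier: "W_mat N \<in> carrier_mat (2 * N) (4 * N)"
  unfolding W_mat_def by (rule carrier_matI) simp_all

text \<open>Each \<open>S l\<close> maps the coefficients \<open>ys l\<close> to \<open>vec (Psi (A l X B l))\<close>: the coordinates of \<open>X\<close> are
  \<open>M l *\<^sub>v ys l\<close>, \<open>W_mat\<close> converts them into \<open>vec (Psi X)\<close>, and the Kronecker factor multiplies by
  \<open>A l\<close> and \<open>B l\<close>. As \<open>Psi\<close> is linear and isometric, real and imaginary parts of the residual are
  the two blocks of the stacked system.\<close>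

lemma fro_norm_residual:
  fixes M :: "nat \<Rightarrow> real mat"
  assumes A: "\<And>l. l < r \<Longrightarrow> A l \<in> carrier_mat m (n l)" and B: "\<And>l. l < r \<Longrightarrow> B l \<in> carrier_mat (s l) t"
    and E: "E \<in> carrier_mat m t"
    and X: "\<And>l. l < r \<Longrightarrow> Xs ! l \<in> carrier_mat (n l) (s l)"
    and M: "\<And>l. l < r \<Longrightarrow> dim_row (M l) = 4 * n l * s l"
    and ys: "\<And>l. l < r \<Longrightarrow> ys l \<in> carrier_vec (dim_col (M l))"
    and Xys: "\<And>l. l < r \<Longrightarrow> vec_of_mat (real_rep (Xs ! l)) = M l *\<^sub>v ys l"
    and S: "\<And>l. l < r \<Longrightarrow> S l = (kronecker (transpose_mat (h_rep (B l))) (cmat1 (A l))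
             + kronecker (transpose_mat (h_rep (rb_j \<cdot>\<^sub>m B l))) (cmat2 (A l)))
           * W_mat (n l * s l) * map_mat of_real (M l)"
    and Q1: "Q1 = hconcat (2 * m * t) (map (\<lambda>l. map_mat Re (S l)) [0..<r])"
    and Q2: "Q2 = hconcat (2 * m * t) (map (\<lambda>l. map_mat Im (S l)) [0..<r])"
    and e: "e = vec_of_mat (map_mat Re (Psi E)) @\<^sub>v vec_of_mat (map_mat Im (Psi E))"
    and y: "y = vconcat (map ys [0..<r])"
  shows "(fro_norm (residual r m t A B E Xs))\<^sup>2
    = ((Q1 @\<^sub>r Q2) *\<^sub>v y - e) \<bullet> ((Q1 @\<^sub>r Q2) *\<^sub>v y - e)"
proof -
  have S_dims: "dim_row (S l) = 2 * m * t" "dim_col (S l) = dim_vec (ys l)"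
    and S_mult: "S l *\<^sub>v map_vec of_real (ys l) = vec_of_mat (Psi (A l * Xs ! l * B l))" if l: "l < r" for l
  proof -
    define K where "K = kronecker (transpose_mat (h_rep (B l))) (cmat1 (A l))
             + kronecker (transpose_mat (h_rep (rb_j \<cdot>\<^sub>m B l))) (cmat2 (A l))"
    let ?N = "n l * s l"
    have "rb_j \<cdot>\<^sub>m B l \<in> carrier_mat (s l) t" using B[OF l] by simp
    from h_rep_carrier[OF this] h_rep_carrier[OF B[OF l]]
    have K: "K \<in> carrier_mat (2 * m * t) (2 * ?N)"
      using A[OF l] unfolding K_def by (intro carrier_matI) (simp_all add: mult_ac)
    have Mc: "map_mat of_real (M l) \<in> carrier_mat (4 * ?N) (dim_col (M l))"
      "M l \<in> carrier_mat (4 * ?N) (dim_col (M l))"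
      using M[OF l] by (auto intro!: carrier_matI simp: mult_ac)
    have v: "map_vec of_real (ys l) \<in> carrier_vec (dim_col (M l))" using ys[OF l] by simp
    have Sl: "S l = K * W_mat ?N * map_mat of_real (M l)" unfolding S[OF l] K_def ..
    show "dim_row (S l) = 2 * m * t" "dim_col (S l) = dim_vec (ys l)"
      unfolding Sl using K ys[OF l] by auto
    have Mv: "map_mat of_real (M l) *\<^sub>v map_vec of_real (ys l) = map_vec of_real (M l *\<^sub>v ys l)"
      by (rule of_real_hom.mult_mat_vec_hom[OF Mc(2) ys[OF l], symmetric])
    have vX: "map_vec complex_of_real (vec_of_mat (real_rep (Xs ! l))) \<in> carrier_vec (4 * ?N)"
      using X[OF l] by (intro carrier_vecI) (simp add: mult_ac)
    have "S l *\<^sub>v map_vec of_real (ys l)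
        = K * W_mat ?N *\<^sub>v (map_mat of_real (M l) *\<^sub>v map_vec of_real (ys l))"
      unfolding Sl by (rule assoc_mult_mat_vec[OF mult_carrier_mat[OF K W_mat_carrier] Mc(1) v])
    also have "\<dots> = K *\<^sub>v (W_mat ?N *\<^sub>v map_vec of_real (vec_of_mat (real_rep (Xs ! l))))"
      unfolding Mv Xys[OF l, symmetric] by (rule assoc_mult_mat_vec[OF K W_mat_carrier vX])
    also have "\<dots> = vec_of_mat (Psi (A l * Xs ! l * B l))"
      unfolding W_mat_mult_real_rep[OF X[OF l]] vec_Psi_product[OF A[OF l] X[OF l] B[OF l]] K_def ..
    finally show "S l *\<^sub>v map_vec of_real (ys l) = vec_of_mat (Psi (A l * Xs ! l * B l))" .
  qed
  let ?Z = "residual r m t A B E Xs"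
  have Z: "?Z \<in> carrier_mat m t" unfolding residual_def by (rule minus_carrier_mat[OF E])
  have Q_mult: "hconcat (2 * m * t) (map (\<lambda>l. map_mat f (S l)) [0..<r]) *\<^sub>v y
        - vec_of_mat (map_mat f (Psi E)) = vec_of_mat (map_mat f (Psi ?Z))"
    if f: "f = Re \<or> f = Im" for f
  proof (rule eq_vecI)
    fix k assume "k < dim_vec (vec_of_mat (map_mat f (Psi ?Z)))"
    then have k: "k < 2 * m * t" using Z by (simp add: mult_ac)
    have idx: "vec_of_mat (map_mat f (Psi Y)) $ k = f (vec_of_mat (Psi Y) $ k)"
      if "Y \<in> carrier_mat m t" for Y
      unfolding map_vec_of_mat[symmetric] using that k by (subst index_map_vec) (auto simp: mult_ac)
    have fS: "(map_mat f (S l) *\<^sub>v ys l) $ k = f (vec_of_mat (Psi (A l * Xs ! l * B l)) $ k)"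
      if "l < r" for l
      using f Re_Im_mult_mat_vec[of "S l" "ys l" k] S_dims[OF that] k
      unfolding S_mult[OF that, symmetric] by auto
    have f_linear: "f ((\<Sum>l<r. g l) - w) = (\<Sum>l<r. f (g l)) - f w" for g w
      using f by (auto simp: Re_sum Im_sum)
    have "(hconcat (2 * m * t) (map (\<lambda>l. map_mat f (S l)) [0..<r]) *\<^sub>v y) $ k
        = (\<Sum>l<r. (map_mat f (S l) *\<^sub>v ys l) $ k)"
      unfolding y using S_dims k by (intro hconcat_mult_blocks) (auto intro!: carrier_matI)
    also have "\<dots> = (\<Sum>l<r. f (vec_of_mat (Psi (A l * Xs ! l * B l)) $ k))"
      by (rule sum.cong) (simp_all add: fS)
    finally have "(hconcat (2 * m * t) (map (\<lambda>l. map_mat f (S l)) [0..<r]) *\<^sub>v y) $ k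
        = (\<Sum>l<r. f (vec_of_mat (Psi (A l * Xs ! l * B l)) $ k))" .
    moreover have "vec_of_mat (Psi ?Z) $ k
        = (\<Sum>l<r. vec_of_mat (Psi (A l * Xs ! l * B l)) $ k) - vec_of_mat (Psi E) $ k"
      by (rule vec_Psi_residual[OF A B E X k])
    ultimately show "(hconcat (2 * m * t) (map (\<lambda>l. map_mat f (S l)) [0..<r]) *\<^sub>v y
        - vec_of_mat (map_mat f (Psi E))) $ k = vec_of_mat (map_mat f (Psi ?Z)) $ k"
      using E k by (subst index_minus_vec) (auto simp: mult_ac idx[OF Z] idx[OF E] f_linear
          simp del: index_mult_mat_vec)
  qed (use E Z in simp)
  have "(Q1 @\<^sub>r Q2) *\<^sub>v y - e = vec_of_mat (map_mat Re (Psi ?Z)) @\<^sub>v vec_of_mat (map_mat Im (Psi ?Z))"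
  proof -
    have y': "y \<in> carrier_vec (\<Sum>l<r. dim_col (M l))"
      unfolding y using ys by (rule vconcat_blocks_carrier)
    have "sum_list (map dim_col (map (\<lambda>l. map_mat f (S l)) [0..<r])) = (\<Sum>l<r. dim_col (M l))"
      for f :: "complex \<Rightarrow> real"
      using S_dims(2) ys by (auto simp: interv_sum_list_conv_sum_set_nat atLeast0LessThan comp_def intro!: sum.cong)
    then have c: "Q1 \<in> carrier_mat (2 * m * t) (\<Sum>l<r. dim_col (M l))"
       "Q2 \<in> carrier_mat (2 * m * t) (\<Sum>l<r. dim_col (M l))"
      unfolding Q1 Q2 by (auto intro!: carrier_matI)
    have ec: "vec_of_mat (map_mat Re (Psi E)) \<in> carrier_vec (2 * m * t)"
       "vec_of_mat (map_mat Im (Psi E)) \<in> carrier_vec (2 * m * t)"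
      using E by (auto intro!: carrier_vecI)
    show ?thesis
      unfolding e append_rows_mult_vec_minus[OF c y' ec] unfolding Q1 Q2 by (simp add: Q_mult)
  qed
  then show ?thesis by (simp add: fro_norm_Psi scalar_prod_append_self)
qed

text \<open>Columns that belong to different diagonal blocks have disjoint supports.\<close>

lemma diag_block_mat_orthonormal_cols:
  fixes Ms :: "'a::comm_ring_1 mat list"
  assumes "\<forall>A\<in>set Ms. transpose_mat A * A = 1\<^sub>m (dim_col A)"
  shows "transpose_mat (diag_block_mat Ms) * diag_block_mat Ms = 1\<^sub>m (dim_col (diag_block_mat Ms))"
  using assms
proof (induction Ms)
  case Nil
  then show ?case by (intro eq_matI) auto
next
  case (Cons A Ms)
  define D where "D = diag_block_mat Ms"
  have D: "transpose_mat D * D = 1\<^sub>m (dim_col D)" using Cons by (simp add: D_def)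
  have A: "transpose_mat A * A = 1\<^sub>m (dim_col A)" using Cons by simp
  have "transpose_mat (diag_block_mat (A # Ms)) = four_block_mat (transpose_mat A)
      (0\<^sub>m (dim_col A) (dim_row D)) (0\<^sub>m (dim_col D) (dim_row A)) (transpose_mat D)"
    unfolding diag_block_mat.simps Let_def D_def[symmetric]
    by (subst transpose_four_block_mat) (auto intro!: carrier_matI)
  then have "transpose_mat (diag_block_mat (A # Ms)) * diag_block_mat (A # Ms)
    = four_block_mat (transpose_mat A * A + 0\<^sub>m (dim_col A) (dim_row D) * 0\<^sub>m (dim_row D) (dim_col A))
        (transpose_mat A * 0\<^sub>m (dim_row A) (dim_col D) + 0\<^sub>m (dim_col A) (dim_row D) * D)
        (0\<^sub>m (dim_col D) (dim_row A) * A + transpose_mat D * 0\<^sub>m (dim_row D) (dim_col A))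
        (0\<^sub>m (dim_col D) (dim_row A) * 0\<^sub>m (dim_row A) (dim_col D) + transpose_mat D * D)"
    unfolding diag_block_mat.simps Let_def D_def[symmetric]
    by (simp only:) (rule mult_four_block_mat, auto intro!: carrier_matI)
  also have "\<dots> = 1\<^sub>m (dim_col A + dim_col D)"
    unfolding A D by (simp add: mat_one_zero_dim)
  finally show ?case by (simp add: D_def[symmetric])
qed

section \<open>Least squares solutions over L-structures\<close>

theorem theorem4p4:
  fixes r m t d :: nat
    and n s :: "nat \<Rightarrow> nat"
    and A B :: "nat \<Rightarrow> rbq mat"
    and E :: "rbq mat"
    and \<Omega> :: "nat \<Rightarrow> rbq vec set"
    and L :: "nat \<Rightarrow> rbq mat set"
    and M :: "nat \<Rightarrow> real mat"
    and S :: "nat \<Rightarrow> complex mat"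
    and Q1 Q2 T R Z H C P :: "real mat"
    and e :: "real vec"
  assumes "r \<ge> 1"
    and "\<forall>l<r. A l \<in> carrier_mat m (n l)"
    and "\<forall>l<r. B l \<in> carrier_mat (s l) t"
    and "E \<in> carrier_mat m t"
    and "\<forall>l<r. real_subspace (n l * s l) (\<Omega> l)"
    and "\<forall>l<r. L l = L_structure (n l) (s l) (\<Omega> l)"
    and "\<forall>l<r. basis_matrix (n l) (s l) (L l) (M l)"
    and "d = (\<Sum>l<r. dim_col (M l))"
    and "\<forall>l<r. S l =
           (kronecker (transpose_mat (h_rep (B l))) (cmat1 (A l))
             + kronecker (transpose_mat (h_rep (rb_j \<cdot>\<^sub>m B l))) (cmat2 (A l)))
           * W_mat (n l * s l) * map_mat of_real (M l)"
    and "Q1 = hconcat (2 * m * t) (map (\<lambda>l. map_mat Re (S l)) [0..<r])"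
    and "Q2 = hconcat (2 * m * t) (map (\<lambda>l. map_mat Im (S l)) [0..<r])"
    and "e = vec_of_mat (map_mat Re (Psi E)) @\<^sub>v vec_of_mat (map_mat Im (Psi E))"
    and "T = diag_block_mat (map M [0..<r])"
    and "R = (1\<^sub>m d - pinv Q1 * Q1) * transpose_mat Q2"
    and "Z = inv_mat (1\<^sub>m (2 * m * t)
           + (1\<^sub>m (2 * m * t) - pinv R * R) * Q2 * pinv Q1 * transpose_mat (pinv Q1)
             * transpose_mat Q2 * (1\<^sub>m (2 * m * t) - pinv R * R))"
    and "H = pinv R
           + (1\<^sub>m (2 * m * t) - pinv R * R) * Z * Q2 * pinv Q1 * transpose_mat (pinv Q1)
             * (1\<^sub>m d - transpose_mat Q2 * pinv R)"
    and "C = append_cols (pinv Q1 - transpose_mat H * Q2 * pinv Q1) (transpose_mat H)"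
    and "P = 1\<^sub>m d - pinv Q1 * Q1 - R * pinv R"
  shows "N_LE r m t A B E L =
           {Xs. length Xs = r \<and> (\<forall>l<r. Xs ! l \<in> carrier_mat (n l) (s l)) \<and>
             (\<exists>y\<in>carrier_vec d. coord_vec Xs = T * C *\<^sub>v e + T * P *\<^sub>v y)}
       \<and> (\<exists>!Xs. is_arg_min tuple_fro_norm (\<lambda>Ys. Ys \<in> N_LE r m t A B E L) Xs)
       \<and> ((\<forall>l<r. transpose_mat (M l) * M l = 1\<^sub>m (dim_col (M l))) \<longrightarrow>
           (\<forall>Xs. is_arg_min tuple_fro_norm (\<lambda>Ys. Ys \<in> N_LE r m t A B E L) Xs \<longrightarrow>
             coord_vec Xs = T * C *\<^sub>v e))"
proof -
  note A = assms(2) and B = assms(3) and E = assms(4) and L = assms(6) and basis = assms(7)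
    and d = assms(8) and S = assms(9) and Q1 = assms(10) and Q2 = assms(11) and e = assms(12)
    and T = assms(13) and R = assms(14) and Z = assms(15) and H = assms(16) and C = assms(17)
    and P = assms(18)
  define ok where "ok Xs \<longleftrightarrow> length Xs = r \<and> (\<forall>l<r. Xs ! l \<in> carrier_mat (n l) (s l))"
    for Xs :: "rbq mat list"
  define p where "p = (\<Sum>l<r. dim_row (M l))"
  define G where "G = Q1 @\<^sub>r Q2"
  have M_rows: "dim_row (M l) = 4 * n l * s l" if "l < r" for l
    using basis that unfolding basis_matrix_def by blast
  have S_dims: "dim_row (S l) = 2 * m * t" "dim_col (S l) = dim_col (M l)" if "l < r" for l
    using S[rule_format, OF that] A[rule_format, OF that] B[rule_format, OF that]
    by (simp_all add: h_rep_def algebra_simps)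
  have Q_cols: "sum_list (map dim_col (map (\<lambda>l. map_mat f (S l)) [0..<r])) = d" for f :: "complex \<Rightarrow> real"
    unfolding d using S_dims(2)
    by (auto simp: interv_sum_list_conv_sum_set_nat atLeast0LessThan comp_def intro!: sum.cong)
  have Q1c: "Q1 \<in> carrier_mat (2 * m * t) d" and Q2c: "Q2 \<in> carrier_mat (2 * m * t) d"
    unfolding Q1 Q2 using Q_cols by (auto intro!: carrier_matI)
  have Gc: "G \<in> carrier_mat (2 * m * t + 2 * m * t) d"
    unfolding G_def by (rule carrier_append_rows[OF Q1c Q2c])
  have ec: "e \<in> carrier_vec (2 * m * t + 2 * m * t)"
    unfolding e using E by (intro carrier_vecI) (simp add: mult_ac)
  have Tc: "T \<in> carrier_mat p d"
    unfolding T p_def d by (intro carrier_matI)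
      (simp_all add: dim_diag_block_mat interv_sum_list_conv_sum_set_nat atLeast0LessThan comp_def)
  note cline = pseudo_inverse_append_rows[OF Q1c Q2c R Z H C, folded G_def]
  note Cc = cline(1) and GC = cline(3)
  have P_eq: "P = 1\<^sub>m d - C * G"
    unfolding P cline(2) using Q1c R by (intro eq_matI) auto
  have CG: "C * G \<in> carrier_mat d d" using Cc Gc by simp
  have dims: "dim_row C = d" "dim_col C = 2 * m * t + 2 * m * t"
    "dim_row G = 2 * m * t + 2 * m * t" "dim_col G = d" using Cc Gc by auto
  have Pc: "P \<in> carrier_mat d d" unfolding P_eq by (rule minus_carrier_mat[OF CG])
  have x: "C *\<^sub>v e \<in> carrier_vec d" using Cc ec by simp
  have T_affine: "T * C *\<^sub>v e + T * P *\<^sub>v z = T *\<^sub>v (C *\<^sub>v e + P *\<^sub>v z)"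
    if "z \<in> carrier_vec d" for z
    using Tc Cc Pc ec that
    by (simp add: mult_add_distrib_mat_vec[OF Tc x mult_mat_vec_carrier[OF Pc that]]
        assoc_mult_mat_vec[OF Tc Cc ec] assoc_mult_mat_vec[OF Tc Pc that])
  have range: "(\<lambda>X. vec_of_mat (real_rep X)) ` L l = (\<lambda>y. M l *\<^sub>v y) ` carrier_vec (dim_col (M l))"
    if "l < r" for l by (rule basis_matrix_range[OF basis[rule_format, OF that]])
  have L_carrier: "L l \<subseteq> carrier_mat (n l) (s l)" if "l < r" for l
    using L that by (auto simp: L_structure_def)

  \<comment> \<open>The coordinate map is a bijection from the feasible tuples to the range of \<open>T\<close>, which
      turns the residual norm into the length of \<open>G *\<^sub>v y - e\<close> and the norm of a tuple into the
      length of its coordinate vector.\<close>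
  have feasible_coords: "ok Xs \<and> (\<exists>y\<in>carrier_vec d. coord_vec Xs = T *\<^sub>v y)"
    if feas: "Xs \<in> feasible_tuples r L" for Xs
  proof -
    have XL: "Xs ! l \<in> L l" if "l < r" for l
      using feas that by (auto simp: feasible_tuples_def)
    have "\<exists>ys. \<forall>l<r. ys l \<in> carrier_vec (dim_col (M l)) \<and> vec_of_mat (real_rep (Xs ! l)) = M l *\<^sub>v ys l"
    proof (intro choice allI)
      fix l show "\<exists>y. l < r \<longrightarrow> y \<in> carrier_vec (dim_col (M l)) \<and> vec_of_mat (real_rep (Xs ! l)) = M l *\<^sub>v y"
      proof (cases "l < r")
        case True
        have "vec_of_mat (real_rep (Xs ! l)) \<in> (\<lambda>y. M l *\<^sub>v y) ` carrier_vec (dim_col (M l))"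
          unfolding range[OF True, symmetric] using XL[OF True] by blast
        then show ?thesis by auto
      qed simp
    qed
    then obtain ys where ys: "\<And>l. l < r \<Longrightarrow> ys l \<in> carrier_vec (dim_col (M l))"
      "\<And>l. l < r \<Longrightarrow> vec_of_mat (real_rep (Xs ! l)) = M l *\<^sub>v ys l" by blast
    have "coord_vec Xs = vconcat (map (\<lambda>l. M l *\<^sub>v ys l) [0..<r])"
      using feas unfolding feasible_tuples_def
      by (subst coord_vec_blocks) (auto intro!: arg_cong[of _ _ vconcat] simp: ys(2))
    also have "\<dots> = T *\<^sub>v vconcat (map ys [0..<r])"
      unfolding T using carrier_vecD[OF ys(1)] by (subst diag_block_mat_mult_blocks) auto
    finally have "coord_vec Xs = T *\<^sub>v vconcat (map ys [0..<r])" .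
    moreover have "vconcat (map ys [0..<r]) \<in> carrier_vec d"
      unfolding d using ys(1) by (rule vconcat_blocks_carrier)
    moreover have "ok Xs"
      using feas XL L_carrier unfolding ok_def feasible_tuples_def by blast
    ultimately show ?thesis by blast
  qed
  have coords_feasible: "Xs \<in> feasible_tuples r L \<and>
      (fro_norm (residual r m t A B E Xs))\<^sup>2 = (G *\<^sub>v y - e) \<bullet> (G *\<^sub>v y - e)"
    if okX: "ok Xs" and y: "y \<in> carrier_vec d" and coord: "coord_vec Xs = T *\<^sub>v y" for Xs y
  proof -
    obtain ys where ys: "\<And>l. l < r \<Longrightarrow> ys l \<in> carrier_vec (dim_col (M l))" "y = vconcat (map ys [0..<r])"
      using vec_to_blocks[OF y[unfolded d]] by blast
    have X: "\<And>l. l < r \<Longrightarrow> Xs ! l \<in> carrier_mat (n l) (s l)" and len: "length Xs = r"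
      using okX unfolding ok_def by auto
    have "vconcat (map (\<lambda>l. vec_of_mat (real_rep (Xs ! l))) [0..<r])
        = vconcat (map (\<lambda>l. M l *\<^sub>v ys l) [0..<r])"
      using coord unfolding coord_vec_blocks[OF len] T ys(2)
      by (subst (asm) diag_block_mat_mult_blocks) (use carrier_vecD[OF ys(1)] in auto)
    then have Xys: "vec_of_mat (real_rep (Xs ! l)) = M l *\<^sub>v ys l" if "l < r" for l
    proof (rule vconcat_blocks_inject[OF _ _ that])
      show "dim_vec (vec_of_mat (real_rep (Xs ! k))) = dim_vec (M k *\<^sub>v ys k)" if "k < r" for k
        using X[OF that] M_rows[OF that] by simp
    qed
    have "Xs ! l \<in> L l" if "l < r" for l
    proof -
      have "vec_of_mat (real_rep (Xs ! l)) \<in> (\<lambda>X. vec_of_mat (real_rep X)) ` L l"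
        unfolding range[OF that] Xys[OF that] using ys(1)[OF that] by blast
      then obtain X' where "X' \<in> L l" "vec_of_mat (real_rep (Xs ! l)) = vec_of_mat (real_rep X')" by blast
      then show ?thesis using real_rep_inject[OF _ X[OF that]] L_carrier[OF that] by blast
    qed
    then have "Xs \<in> feasible_tuples r L" using len by (simp add: feasible_tuples_def)
    moreover have "(fro_norm (residual r m t A B E Xs))\<^sup>2 = (G *\<^sub>v y - e) \<bullet> (G *\<^sub>v y - e)"
      unfolding G_def
      by (rule fro_norm_residual[OF _ _ E X M_rows ys(1) Xys _ Q1 Q2 e ys(2)]) (use A B S in auto)
    ultimately show ?thesis ..
  qed
  have coords_surj: "\<exists>Xs. ok Xs \<and> coord_vec Xs = T *\<^sub>v y" if y: "y \<in> carrier_vec d" for y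
  proof -
    obtain ys where ys: "\<And>l. l < r \<Longrightarrow> ys l \<in> carrier_vec (dim_col (M l))" "y = vconcat (map ys [0..<r])"
      using vec_to_blocks[OF y[unfolded d]] by blast
    have "\<exists>X. \<forall>l<r. X l \<in> L l \<and> vec_of_mat (real_rep (X l)) = M l *\<^sub>v ys l"
    proof (intro choice allI)
      fix l show "\<exists>X. l < r \<longrightarrow> X \<in> L l \<and> vec_of_mat (real_rep X) = M l *\<^sub>v ys l"
      proof (cases "l < r")
        case True
        have "M l *\<^sub>v ys l \<in> (\<lambda>X. vec_of_mat (real_rep X)) ` L l"
          unfolding range[OF True] using ys(1)[OF True] by blast
        then show ?thesis by auto
      qed simp
    qed
    then obtain X where X: "\<And>l. l < r \<Longrightarrow> X l \<in> L l"
      "\<And>l. l < r \<Longrightarrow> vec_of_mat (real_rep (X l)) = M l *\<^sub>v ys l" by blast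
    let ?Xs = "map X [0..<r]"
    have "coord_vec ?Xs = vconcat (map (\<lambda>l. M l *\<^sub>v ys l) [0..<r])"
      by (subst coord_vec_blocks[of _ r]) (auto intro!: arg_cong[of _ _ vconcat] simp: X(2))
    also have "\<dots> = T *\<^sub>v y"
      unfolding T ys(2) using carrier_vecD[OF ys(1)] by (subst diag_block_mat_mult_blocks) auto
    finally show ?thesis using X(1) L_carrier by (intro exI[of _ ?Xs]) (auto simp: ok_def)
  qed
  have coord_inj: "Xs = Ys" if "ok Xs" "ok Ys" "coord_vec Xs = coord_vec Ys" for Xs Ys
    using that unfolding ok_def by (intro coord_vec_inject[of Xs Ys r n s]) auto
  have fro_le: "fro_norm (residual r m t A B E Xs) \<le> fro_norm (residual r m t A B E Ys)
      \<longleftrightarrow> (fro_norm (residual r m t A B E Xs))\<^sup>2 \<le> (fro_norm (residual r m t A B E Ys))\<^sup>2" for Xs Ys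
    by (rule power_mono_iff[symmetric]) (auto simp: fro_norm_def intro!: sum_nonneg)
  note solutions = least_squares_solutions[OF GC Gc ec, folded P_eq]

  have minimizers: "Xs \<in> N_LE r m t A B E L \<longleftrightarrow>
      ok Xs \<and> (\<exists>z\<in>carrier_vec d. coord_vec Xs = T * C *\<^sub>v e + T * P *\<^sub>v z)" for Xs
  proof
    assume "Xs \<in> N_LE r m t A B E L"
    then have feas: "Xs \<in> feasible_tuples r L"
      and min: "\<And>Ys. Ys \<in> feasible_tuples r L \<Longrightarrow>
        fro_norm (residual r m t A B E Xs) \<le> fro_norm (residual r m t A B E Ys)"
      unfolding N_LE_def is_arg_min_def by (auto simp: not_less)
    from feasible_coords[OF feas] obtain y where okX: "ok Xs" and y: "y \<in> carrier_vec d" "coord_vec Xs = T *\<^sub>v y"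
      by blast
    have "(G *\<^sub>v y - e) \<bullet> (G *\<^sub>v y - e) \<le> (G *\<^sub>v z - e) \<bullet> (G *\<^sub>v z - e)" if z: "z \<in> carrier_vec d" for z
    proof -
      obtain Ys where Ys: "ok Ys" "coord_vec Ys = T *\<^sub>v z" using coords_surj[OF z] by blast
      show ?thesis
        using coords_feasible[OF okX y] coords_feasible[OF Ys(1) z Ys(2)] min[of Ys] fro_le by simp
    qed
    then obtain z where "z \<in> carrier_vec d" "y = C *\<^sub>v e + P *\<^sub>v z"
      using solutions[OF y(1)] by blast
    then show "ok Xs \<and> (\<exists>z\<in>carrier_vec d. coord_vec Xs = T * C *\<^sub>v e + T * P *\<^sub>v z)"
      using okX y(2) T_affine by auto
  next
    assume "ok Xs \<and> (\<exists>z\<in>carrier_vec d. coord_vec Xs = T * C *\<^sub>v e + T * P *\<^sub>v z)"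
    then obtain z where okX: "ok Xs" and z: "z \<in> carrier_vec d"
      "coord_vec Xs = T *\<^sub>v (C *\<^sub>v e + P *\<^sub>v z)"
      using T_affine by auto
    let ?y = "C *\<^sub>v e + P *\<^sub>v z"
    have y: "?y \<in> carrier_vec d" using x Pc z by simp
    have min: "\<forall>w\<in>carrier_vec d. (G *\<^sub>v ?y - e) \<bullet> (G *\<^sub>v ?y - e) \<le> (G *\<^sub>v w - e) \<bullet> (G *\<^sub>v w - e)"
      using solutions[OF y] z(1) by blast
    have "fro_norm (residual r m t A B E Xs) \<le> fro_norm (residual r m t A B E Ys)"
      if Ys: "Ys \<in> feasible_tuples r L" for Ys
    proof -
      obtain w where w: "ok Ys" "w \<in> carrier_vec d" "coord_vec Ys = T *\<^sub>v w"
        using feasible_coords[OF Ys] by blast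
      show ?thesis
        unfolding fro_le using coords_feasible[OF okX y z(2)] coords_feasible[OF w] min w(2) by simp
    qed
    then show "Xs \<in> N_LE r m t A B E L"
      using coords_feasible[OF okX y z(2)] unfolding N_LE_def is_arg_min_def
      by (auto simp: not_less)
  qed

  define c where "c = T * C *\<^sub>v e"
  define J where "J = T * P"
  have cc: "c \<in> carrier_vec p" unfolding c_def using Tc Cc ec by simp
  have Jc: "J \<in> carrier_mat p d" unfolding J_def using Tc Pc by simp
  \<comment> \<open>The length of \<open>c + J *\<^sub>v z\<close> is a least squares objective with right-hand side \<open>- c\<close>.\<close>
  have shift: "c + J *\<^sub>v z = J *\<^sub>v z - (- c)" for z
    using cc Jc by (intro eq_vecI) auto
  have J_pinv: "pinv J *\<^sub>v (- c) \<in> carrier_vec d"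
    using Jc cc by (intro mult_mat_vec_carrier[of _ _ p]) (auto intro!: carrier_matI)
  define a where "a = c + J *\<^sub>v (pinv J *\<^sub>v (- c))"
  have tuple_le: "tuple_fro_norm Xs \<le> tuple_fro_norm Ys
      \<longleftrightarrow> coord_vec Xs \<bullet> coord_vec Xs \<le> coord_vec Ys \<bullet> coord_vec Ys" for Xs Ys
    by (simp add: tuple_fro_norm_coord)
  have N_surj: "\<exists>Ys\<in>N_LE r m t A B E L. coord_vec Ys = c + J *\<^sub>v z" if "z \<in> carrier_vec d" for z
  proof -
    have "C *\<^sub>v e + P *\<^sub>v z \<in> carrier_vec d" using x Pc that by simp
    from coords_surj[OF this] obtain Ys where "ok Ys" "coord_vec Ys = T *\<^sub>v (C *\<^sub>v e + P *\<^sub>v z)" by blast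
    moreover from this have coord: "coord_vec Ys = T * C *\<^sub>v e + T * P *\<^sub>v z"
      using T_affine[OF that] by simp
    ultimately have "Ys \<in> N_LE r m t A B E L" using minimizers that by blast
    then show ?thesis using coord unfolding c_def J_def by blast
  qed
  have "- c \<in> carrier_vec p" using cc by simp
  note min_norm = least_squares_solutions(1)[OF is_pseudo_inverse_pinv Jc this, folded shift]
  have arg_min_iff: "is_arg_min tuple_fro_norm (\<lambda>Ys. Ys \<in> N_LE r m t A B E L) Xs
      \<longleftrightarrow> Xs \<in> N_LE r m t A B E L \<and> coord_vec Xs = a" for Xs
  proof (cases "Xs \<in> N_LE r m t A B E L")
    case True
    then obtain z where z: "z \<in> carrier_vec d" "coord_vec Xs = c + J *\<^sub>v z"
      unfolding minimizers c_def J_def by blast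
    have "is_arg_min tuple_fro_norm (\<lambda>Ys. Ys \<in> N_LE r m t A B E L) Xs
        \<longleftrightarrow> (\<forall>Ys\<in>N_LE r m t A B E L. coord_vec Xs \<bullet> coord_vec Xs \<le> coord_vec Ys \<bullet> coord_vec Ys)"
      using True unfolding is_arg_min_def by (auto simp: not_less tuple_le)
    also have "\<dots> \<longleftrightarrow> (\<forall>w\<in>carrier_vec d. (c + J *\<^sub>v z) \<bullet> (c + J *\<^sub>v z) \<le> (c + J *\<^sub>v w) \<bullet> (c + J *\<^sub>v w))"
      unfolding z(2)
    proof (intro iffI ballI)
      fix w :: "real vec"
      assume "\<forall>Ys\<in>N_LE r m t A B E L.
        (c + J *\<^sub>v z) \<bullet> (c + J *\<^sub>v z) \<le> coord_vec Ys \<bullet> coord_vec Ys" "w \<in> carrier_vec d"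
      then show "(c + J *\<^sub>v z) \<bullet> (c + J *\<^sub>v z) \<le> (c + J *\<^sub>v w) \<bullet> (c + J *\<^sub>v w)"
        using N_surj[of w] by auto
    next
      fix Ys
      assume "\<forall>w\<in>carrier_vec d. (c + J *\<^sub>v z) \<bullet> (c + J *\<^sub>v z) \<le> (c + J *\<^sub>v w) \<bullet> (c + J *\<^sub>v w)"
        "Ys \<in> N_LE r m t A B E L"
      then show "(c + J *\<^sub>v z) \<bullet> (c + J *\<^sub>v z) \<le> coord_vec Ys \<bullet> coord_vec Ys"
        unfolding minimizers c_def J_def by auto
    qed
    also have "\<dots> \<longleftrightarrow> J *\<^sub>v z = J *\<^sub>v (pinv J *\<^sub>v (- c))"
      by (rule min_norm[OF z(1)])
    also have "\<dots> \<longleftrightarrow> coord_vec Xs = a"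
      unfolding z(2) a_def
    proof
      assume eq: "c + J *\<^sub>v z = c + J *\<^sub>v (pinv J *\<^sub>v (- c))"
      show "J *\<^sub>v z = J *\<^sub>v (pinv J *\<^sub>v (- c))"
      proof (rule eq_vecI)
        fix i assume i: "i < dim_vec (J *\<^sub>v (pinv J *\<^sub>v (- c)))"
        have "(c + J *\<^sub>v z) $ i = (c + J *\<^sub>v (pinv J *\<^sub>v (- c))) $ i" unfolding eq ..
        then show "(J *\<^sub>v z) $ i = (J *\<^sub>v (pinv J *\<^sub>v (- c))) $ i"
          using i by (simp del: index_mult_mat_vec)
      qed simp
    qed simp
    finally show ?thesis using True by simp
  qed (simp add: is_arg_min_def)
  have "\<exists>!Xs. is_arg_min tuple_fro_norm (\<lambda>Ys. Ys \<in> N_LE r m t A B E L) Xs"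
    unfolding arg_min_iff using N_surj[OF J_pinv] coord_inj minimizers unfolding a_def[symmetric] by blast
  moreover have "coord_vec Xs = T * C *\<^sub>v e"
    if orth: "\<forall>l<r. transpose_mat (M l) * M l = 1\<^sub>m (dim_col (M l))"
      and arg_min: "is_arg_min tuple_fro_norm (\<lambda>Ys. Ys \<in> N_LE r m t A B E L) Xs" for Xs
  proof -
    \<comment> \<open>\<open>J\<^sup>T c = P\<^sup>T T\<^sup>T T C e = P C e = 0\<close>, so the correction to \<open>c\<close> in \<open>a\<close> vanishes.\<close>
    have "transpose_mat T * T = 1\<^sub>m d"
      using diag_block_mat_orthonormal_cols[of "map M [0..<r]"] orth Tc unfolding T[symmetric] by auto
    moreover have PtP: "transpose_mat P = P"
    proof -
      have "transpose_mat (C * G) = C * G" using GC by (simp only: is_pseudo_inverse_def)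
      then show ?thesis unfolding P_eq by (subst mat_transpose_dim(3)) (simp_all add: dims)
    qed
    moreover have PC: "P * C = 0\<^sub>m d (2 * m * t + 2 * m * t)"
    proof -
      have "C * G * C = C" using GC by (simp only: is_pseudo_inverse_def)
      then show ?thesis
        unfolding P_eq by (subst mat_distrib_dim(2)) (simp_all add: dims mat_one_zero_dim)
    qed
    moreover have "transpose_mat J * (T * C) = P * (transpose_mat T * T) * C"
      using Tc Pc Cc PtP unfolding J_def by (simp add: mat_transpose_dim(1) mat_mult_assoc_dim)
    ultimately have JTC: "transpose_mat J * (T * C) = 0\<^sub>m d (2 * m * t + 2 * m * t)"
      using Pc by simp
    have "transpose_mat J *\<^sub>v c = (transpose_mat J * (T * C)) *\<^sub>v e"
      unfolding c_def
      by (rule assoc_mult_mat_vec[OF _ mult_carrier_mat[OF Tc Cc] ec, symmetric]) (use Jc in simp)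
    then have Jtc: "transpose_mat J *\<^sub>v c = 0\<^sub>v d"
      unfolding JTC using ec by (intro eq_vecI) (auto simp: scalar_prod_def)
    have Jtc': "transpose_mat J *\<^sub>v (- c) = 0\<^sub>v d"
    proof (rule eq_vecI)
      fix i assume "i < dim_vec (0\<^sub>v d :: real vec)"
      then have "(transpose_mat J *\<^sub>v (- c)) $ i = - (transpose_mat J *\<^sub>v c) $ i"
        using Jc by (simp add: scalar_prod_def sum_negf)
      then show "(transpose_mat J *\<^sub>v (- c)) $ i = 0\<^sub>v d $ i"
        unfolding Jtc using \<open>i < dim_vec (0\<^sub>v d :: real vec)\<close> by simp
    qed (use Jc in simp)
    have pJ: "pinv J \<in> carrier_mat d p" using Jc by (auto intro!: carrier_matI)
    have JpJ: "J * pinv J = transpose_mat (pinv J) * transpose_mat J"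
      using pinv_eqs(3)[of J] by (simp add: mat_transpose_dim(1))
    have "J *\<^sub>v (pinv J *\<^sub>v (- c)) = J * pinv J *\<^sub>v (- c)"
      by (rule assoc_mult_mat_vec[OF Jc pJ \<open>- c \<in> carrier_vec p\<close>, symmetric])
    also have "\<dots> = transpose_mat (pinv J) *\<^sub>v (transpose_mat J *\<^sub>v (- c))"
      unfolding JpJ
      by (rule assoc_mult_mat_vec[OF _ _ \<open>- c \<in> carrier_vec p\<close>, of _ p d]) (use Jc pJ in simp_all)
    also have "\<dots> = 0\<^sub>v p"
      unfolding Jtc' using pJ by (intro eq_vecI) (auto simp: scalar_prod_def)
    finally have "J *\<^sub>v (pinv J *\<^sub>v (- c)) = 0\<^sub>v p" .
    then show ?thesis using arg_min cc unfolding arg_min_iff a_def c_def[symmetric] by simp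
  qed
  ultimately show ?thesis using minimizers unfolding ok_def by blast
qed

end
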